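(* For Lebesgue-almost every irrational $\alpha\in(0,1)$ and every $c\in(0,1)$, \[ K_0\le \limsup_{n\to\infty} S(\alpha,n,cn)^{1/cn}\le K_0^{1/c}\,(K_{-1})^{1-\frac1c}, \] where $K_0=\prod_{r=1}^\infty\left(1+\frac{1}{r(r+2)}\right)^{\log_2 r}$ and $K_{-1}=\left(\sum_{r=1}^\infty -r^{-1}\log_2\!\left(1-\frac{1}{(r+1)^2}\right)\right)^{-1}$.
   Context: Every irrational $\alpha\in(0,1)$ has a unique continued fraction expansion $\alpha = 1/(a_1(\alpha)+1/(a_2(\alpha)+\cdots))$ with digits $a_i(\alpha)\in\mathbb{N}_{\ge1}$. For $1\le k\le n$ integers, \[ S(\alpha,n,k) := \binom{n}{k}^{-1}\sum_{1\le i_1<\cdots<i_k\le n} a_{i_1}(\alpha)\cdots a_{i_k}(\alpha). \] Convention: $S(\alpha,n,cn)^{1/cn}$ means $S(\alpha,n,\lceil cn\rceil)^{1/\lceil cn\rceil}$. *)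

theory Defs
  imports "HOL-Analysis.Analysis"
begin

definition gauss_map :: "real \<Rightarrow> real" where
  "gauss_map x = frac (1 / x)"

text \<open>Continued fraction digits a_i(x) for i \<ge> 1: a_i(x) = floor(1 / T^(i-1) x).
  (Index 0 is not used.)\<close>
definition cf_digit :: "real \<Rightarrow> nat \<Rightarrow> nat" where
  "cf_digit x i = nat \<lfloor>1 / (gauss_map ^^ (i - 1)) x\<rfloor>"

definition S_cf :: "real \<Rightarrow> nat \<Rightarrow> nat \<Rightarrow> real" where
  "S_cf x n k = (\<Sum>I\<in>{I. I \<subseteq> {1..n} \<and> card I = k}. \<Prod>i\<in>I. real (cf_digit x i))
                  / real (n choose k)"

text \<open>Convention: S(alpha,n,cn)^(1/cn) means S(alpha,n,ceil(cn))^(1/ceil(cn)).\<close>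
definition S_root :: "real \<Rightarrow> real \<Rightarrow> nat \<Rightarrow> real" where
  "S_root x c n = (let k = nat \<lceil>c * real n\<rceil> in S_cf x n k powr (1 / real k))"

definition Khinchin_K0 :: real where
  "Khinchin_K0 = (\<Prod>r. (1 + 1 / (real (Suc r) * (real (Suc r) + 2))) powr (log 2 (real (Suc r))))"

definition Khinchin_Kminus1 :: real where
  "Khinchin_Kminus1 = inverse (\<Sum>r. - (1 / real (Suc r)) * log 2 (1 - 1 / (real (Suc r) + 1)^2))"

end

theory Submission
  imports Defs "HOL-Probability.Probability" "HOL-Library.Discrete_Functions" "HOL-Real_Asymp.Real_Asymp"
begin

text \<open>
  Write \<open>P = a\<^sub>1 \<cdots> a\<^sub>n\<close> and let \<open>m\<close> be the mean of the \<open>1 / a\<^sub>i\<close>. The AM-GM inequality over the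
  \<open>k\<close>-subsets gives \<open>S(n,k)\<^sup>1\<^sup>/\<^sup>k \<ge> P\<^sup>1\<^sup>/\<^sup>n\<close>. In the other direction
  \<open>\<Prod>(t + a\<^sub>i) = P \<Prod>(1 + t / a\<^sub>i) \<le> P (1 + t m)\<^sup>n\<close>; comparing coefficients of \<open>t\<close> for the optimal \<open>t\<close>
  replaces Maclaurin's inequality up to a factor \<open>n + 1\<close>, which disappears under the \<open>k\<close>-th root. So
  both bounds follow from the almost sure convergence of the averages of \<open>ln a\<^sub>i\<close> and \<open>1 / a\<^sub>i\<close>.

  These averages converge by a law of large numbers for exponentially decorrelating variables
  (Chebyshev along the squares, then monotone interpolation), so that no ergodic theorem is needed.
  The decorrelation holds because the transfer operator of the Gauss map contracts Lipschitz
  constants by the factor \<open>7/8\<close>.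
\<close>

text \<open>A digit has infinite mean, so the arithmetic mean of the digits gives no usable upper
  bound. Reciprocals are bounded, and a k-fold product of digits is \<open>P\<close> times an
  (n-k)-fold product of reciprocals. The k-th root of \<open>m ^ (n - k)\<close> tends to the limit
  of \<open>m\<close> raised to 1/c - 1; that limit is 1/K_{-1}, whence the exponent 1 - 1/c. The
  two digit averages do not mention c, so one null set serves every c.

  The law of large numbers rests on second moments, which are finite for ln a_i and 1/a_i. As
  functions of the point both jump at every change of digit, so neither is Lipschitz, and ln a_i is
  unbounded as well. One application of the transfer operator makes them Lipschitz; the contraction
  acts from then on.

  The constant is 7/8 = 5/8 + 1/4: moving the point inside the branches costs 5/8, moving it inside
  the weights costs 1/4. Bounding the variation of the weights term by term gives a constant far
  above 1, so the second part exploits cancellation between neighbouring branches.\<close>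

section \<open>Means of elementary symmetric functions\<close>

text \<open>The binomial expansion of \<open>(k + m) ^ (k + m)\<close> has \<open>k + m + 1\<close>
  terms, and the one with index \<open>k\<close> is the largest: the binomial distribution with
  success probability k/(k+m) has its mode at k. Consecutive terms are compared after multiplication
  by \<open>Suc j\<close>, which avoids division and leaves only \<open>(k + m - j) * k\<close>
  against \<open>Suc j * m\<close>.\<close>

lemma binomial_largest_term:
  fixes k m :: nat
  shows "(k + m) ^ (k + m) \<le> (k + m + 1) * (((k + m) choose k) * k ^ k * m ^ m)"
proof -
  define b where "b j = ((k + m) choose j) * k ^ j * m ^ (k + m - j)" for j
  have step: "b (Suc j) * Suc j = (((k + m) choose j) * k ^ j * m ^ (k + m - Suc j)) * ((k + m - j) * k)"
    and step': "b j * Suc j = (((k + m) choose j) * k ^ j * m ^ (k + m - Suc j)) * (Suc j * m)"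
    if "j < k + m" for j
  proof -
    have "((k + m) choose Suc j) * Suc j = ((k + m) choose j) * (k + m - j)"
      using binomial_absorb_comp[of "k + m" j] binomial_absorption[of j "k + m"] that
      by (simp add: mult.commute del: binomial_Suc_Suc)
    then show "b (Suc j) * Suc j = (((k + m) choose j) * k ^ j * m ^ (k + m - Suc j)) * ((k + m - j) * k)"
      unfolding b_def by (simp add: mult_ac del: mult_Suc mult_Suc_right)
    have "k + m - j = Suc (k + m - Suc j)" using that by simp
    then show "b j * Suc j = (((k + m) choose j) * k ^ j * m ^ (k + m - Suc j)) * (Suc j * m)"
      unfolding b_def by (simp add: mult_ac del: mult_Suc mult_Suc_right)
  qed
  have up: "b j \<le> b (Suc j)" if "j < k" for j
  proof -
    have "Suc j * m \<le> (k + m - j) * k"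
      using that mult_mono[of "Suc j" k m "k + m - j"] by (simp add: mult.commute)
    then have "b j * Suc j \<le> b (Suc j) * Suc j"
      using that by (subst step, simp, subst step', simp) (rule mult_left_mono, auto)
    then show ?thesis by (simp del: mult_Suc_right)
  qed
  have down: "b (Suc j) \<le> b j" if "k \<le> j" "j < k + m" for j
  proof -
    have "(k + m - j) * k \<le> Suc j * m"
      using that mult_mono[of "k + m - j" m k "Suc j"] by (simp add: mult.commute)
    then have "b (Suc j) * Suc j \<le> b j * Suc j"
      using that by (subst step, simp, subst step', simp) (rule mult_left_mono, auto)
    then show ?thesis by (simp del: mult_Suc_right)
  qed
  have left: "b j \<le> b k" if "j \<le> k" for j
    using that by (induction j rule: inc_induct) (auto intro: order_trans up)
  have right: "j \<le> k + m \<longrightarrow> b j \<le> b k" if "k \<le> j" for j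
    using that by (induction j rule: dec_induct) (auto dest: down)
  have "(k + m) ^ (k + m) = (\<Sum>j\<le>k + m. b j)"
    unfolding b_def by (subst binomial) simp
  also have "\<dots> \<le> (\<Sum>j\<le>k + m. b k)"
    using left right by (intro sum_mono) (metis atMost_iff nle_le)
  finally show ?thesis by (simp add: b_def)
qed

text \<open>Double counting: removing \<open>i\<close> puts the \<open>k\<close>-subsets containing
  \<open>i\<close> in bijection with the \<open>(k - 1)\<close>-subsets of
  \<open>A - {i}\<close>.\<close>

lemma sum_subsets_swap:
  fixes f :: "'a \<Rightarrow> real"
  assumes "finite A" "1 \<le> k" "k \<le> card A"
  shows "(\<Sum>I\<in>{I. I \<subseteq> A \<and> card I = k}. \<Sum>i\<in>I. f i)
          = real ((card A - 1) choose (k - 1)) * (\<Sum>i\<in>A. f i)"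
proof -
  let ?C = "{I. I \<subseteq> A \<and> card I = k}"
  have fin: "finite ?C" using assms(1) by simp
  have "(\<Sum>I\<in>?C. \<Sum>i\<in>I. f i) = (\<Sum>I\<in>?C. \<Sum>i\<in>{i \<in> A. i \<in> I}. f i)"
    by (intro sum.cong refl arg_cong2[where f=sum]) auto
  also have "\<dots> = (\<Sum>i\<in>A. \<Sum>I\<in>{I \<in> ?C. i \<in> I}. f i)"
    using fin assms(1) by (rule sum.swap_restrict)
  also have "\<dots> = (\<Sum>i\<in>A. real ((card A - 1) choose (k - 1)) * f i)"
  proof (rule sum.cong[OF refl])
    fix i assume i: "i \<in> A"
    have "bij_betw (insert i) {J. J \<subseteq> A - {i} \<and> card J = k - 1} {I \<in> ?C. i \<in> I}"
    proof (rule bij_betw_byWitness[where f' = "\<lambda>I. I - {i}"])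
      show "insert i ` {J. J \<subseteq> A - {i} \<and> card J = k - 1} \<subseteq> {I \<in> ?C. i \<in> I}"
      proof safe
        fix J assume J: "J \<subseteq> A - {i}" "card J = k - 1"
        have "finite J" "i \<notin> J" using J assms(1) finite_subset[of J A] by auto
        then show "card (insert i J) = k" using J assms(2) by simp
      qed (use i in auto)
      show "(\<lambda>I. I - {i}) ` {I \<in> ?C. i \<in> I} \<subseteq> {J. J \<subseteq> A - {i} \<and> card J = k - 1}"
        by (auto simp: card_Diff_singleton)
    qed blast+
    then have "card {I \<in> ?C. i \<in> I} = card {J. J \<subseteq> A - {i} \<and> card J = k - 1}"
      by (rule bij_betw_same_card[symmetric])
    also have "\<dots> = (card A - 1) choose (k - 1)"
      using n_subsets[of "A - {i}" "k - 1"] assms(1) i by simp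
    finally show "(\<Sum>I\<in>{I \<in> ?C. i \<in> I}. f i) = real ((card A - 1) choose (k - 1)) * f i"
      by simp
  qed
  finally show ?thesis by (simp add: sum_distrib_left)
qed

text \<open>In the geometric mean of all k-fold products, each ln a_i is counted with relative
  frequency C(n-1,k-1) / C(n,k) = k/n, so that mean is P^(k/n). It is written with
  \<open>exp\<close> and \<open>ln\<close> because averages of logarithms are what converges
  later.\<close>

lemma elementary_symmetric_mean_ge:
  fixes a :: "'a \<Rightarrow> real"
  assumes fin: "finite A" and k: "1 \<le> k" "k \<le> card A" and pos: "\<And>i. i \<in> A \<Longrightarrow> 0 < a i"
  shows "exp (real k * ((\<Sum>i\<in>A. ln (a i)) / real (card A)))
          \<le> (\<Sum>I\<in>{I. I \<subseteq> A \<and> card I = k}. \<Prod>i\<in>I. a i) / real (card A choose k)"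
proof -
  let ?C = "{I. I \<subseteq> A \<and> card I = k}"
  let ?n = "card A"
  have finC: "finite ?C" using fin by simp
  have cC: "card ?C = ?n choose k" using n_subsets[OF fin] by simp
  have cpos: "0 < ?n choose k" using k by simp
  then have ne: "?C \<noteq> {}" using cC by (metis card.empty less_irrefl)
  have Ppos: "0 < (\<Prod>i\<in>I. a i)" if "I \<in> ?C" for I
    using that pos by (intro prod_pos) auto
  have "k * (?n choose k) = ?n * ((?n - 1) choose (k - 1))"
    using binomial_absorption[of "k - 1" "?n"] k by simp
  then have ratio: "real ((?n - 1) choose (k - 1)) / real (?n choose k) = real k / real ?n"
    using cpos k by (simp add: divide_simps flip: of_nat_mult)
  have "ln (\<Prod>I\<in>?C. \<Prod>i\<in>I. a i) = (\<Sum>I\<in>?C. ln (\<Prod>i\<in>I. a i))"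
    by (intro ln_prod finC less_imp_neq[symmetric] Ppos)
  also have "\<dots> = (\<Sum>I\<in>?C. \<Sum>i\<in>I. ln (a i))"
  proof (intro sum.cong refl ln_prod)
    fix I assume "I \<in> ?C"
    then show "finite I" using fin by (auto intro: finite_subset)
    fix i assume "i \<in> I"
    then show "a i \<noteq> 0" using \<open>I \<in> ?C\<close> pos[of i] by auto
  qed
  also have "\<dots> = real ((?n - 1) choose (k - 1)) * (\<Sum>i\<in>A. ln (a i))"
    by (rule sum_subsets_swap[OF fin k])
  finally have "ln (\<Prod>I\<in>?C. \<Prod>i\<in>I. a i) / real (?n choose k)
      = real ((?n - 1) choose (k - 1)) / real (?n choose k) * (\<Sum>i\<in>A. ln (a i))"
    by simp
  then have L: "ln (\<Prod>I\<in>?C. \<Prod>i\<in>I. a i) / real (?n choose k) = real k * ((\<Sum>i\<in>A. ln (a i)) / real ?n)"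
    unfolding ratio by simp
  have "(\<Prod>I\<in>?C. \<Prod>i\<in>I. a i) powr (1 / card ?C) \<le> (\<Sum>I\<in>?C. (\<Prod>i\<in>I. a i) / card ?C)"
    using Ppos by (intro arith_geom_mean finC ne) (auto simp: less_imp_le)
  moreover have "(\<Prod>I\<in>?C. \<Prod>i\<in>I. a i) > 0" using Ppos by (rule prod_pos)
  ultimately show ?thesis
    using L by (simp add: powr_def cC sum_divide_distrib)
qed

text \<open>Up to the factor n + 1 this is Maclaurin's inequality for the reciprocals, via e_k(a) =
  P e_{n-k}(1/a); hence the exponent \<open>n - k\<close>. At the optimal \<open>t\<close> one has 1
  + t m = n/k, and the resulting quotient n^n / (k^k d^d), with n = k + d, is compared with the
  binomial coefficient by \<open>binomial_largest_term\<close>.\<close>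

lemma elementary_symmetric_mean_le:
  fixes a :: "'a \<Rightarrow> real"
  assumes fin: "finite A" and n: "card A = n" and k: "1 \<le> k" "k < n"
    and pos: "\<And>i. i \<in> A \<Longrightarrow> 0 < a i"
  defines "m \<equiv> (\<Sum>i\<in>A. 1 / a i) / real n"
  shows "(\<Sum>I\<in>{I. I \<subseteq> A \<and> card I = k}. \<Prod>i\<in>I. a i) / real (n choose k)
          \<le> (real n + 1) * (\<Prod>i\<in>A. a i) * m ^ (n - k)"
proof -
  define e where "e = (\<Sum>I\<in>{I. I \<subseteq> A \<and> card I = k}. \<Prod>i\<in>I. a i)"
  define P where "P = (\<Prod>i\<in>A. a i)"
  define d where "d = n - k"
  have d: "0 < d" "n = k + d" using k by (auto simp: d_def)
  have ne: "A \<noteq> {}" using n k by auto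
  have m: "0 < m" unfolding m_def using k n pos fin ne by (intro divide_pos_pos sum_pos) auto
  have P: "0 < P" unfolding P_def using pos by (rule prod_pos)
  \<comment> \<open>The value of \<open>t\<close> minimising \<open>(1 + t * m) ^ n / t ^ (n - k)\<close>.\<close>
  define t where "t = real d / (real k * m)"
  have t: "0 < t" using d k m by (simp add: t_def)
  have "t ^ d * e = (\<Sum>I\<in>{I. I \<subseteq> A \<and> card I = k}. (\<Prod>i\<in>I. a i) * (\<Prod>i\<in>A - I. t))"
    unfolding e_def sum_distrib_left
    using fin n d by (intro sum.cong refl) (auto simp: card_Diff_subset finite_subset mult.commute)
  also have "\<dots> \<le> (\<Sum>I\<in>Pow A. (\<Prod>i\<in>I. a i) * (\<Prod>i\<in>A - I. t))"
    using fin t pos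
    by (intro sum_mono2) (auto intro!: mult_nonneg_nonneg prod_nonneg less_imp_le[OF pos])
  also have "\<dots> = (\<Prod>i\<in>A. a i + t)" using prod_add[OF fin, of a "\<lambda>_. t"] by simp
  also have "\<dots> = (\<Prod>i\<in>A. a i * (1 + t / a i))"
    using pos by (intro prod.cong refl) (auto simp: divide_simps dest!: pos)
  also have "\<dots> = P * (\<Prod>i\<in>A. 1 + t / a i)" by (simp add: prod.distrib P_def)
  also have "\<dots> \<le> P * (1 + t * m) ^ n"
  proof (rule mult_left_mono)
    have f: "0 < 1 + t / a i" if "i \<in> A" for i using t pos[OF that] by (simp add: add_pos_pos)
    have "(\<Prod>i\<in>A. 1 + t / a i) powr (1 / card A) \<le> (\<Sum>i\<in>A. (1 + t / a i) / card A)"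
      using f by (intro arith_geom_mean fin ne) (auto intro: less_imp_le)
    also have "\<dots> = 1 + t * m"
      using n k by (simp add: m_def add_divide_distrib sum.distrib sum_distrib_left sum_divide_distrib)
    finally have "((\<Prod>i\<in>A. 1 + t / a i) powr (1 / n)) ^ n \<le> (1 + t * m) ^ n"
      unfolding n by (rule power_mono) simp
    moreover have "((\<Prod>i\<in>A. 1 + t / a i) powr (1 / n)) ^ n = (\<Prod>i\<in>A. 1 + t / a i)"
    proof -
      have "0 < (\<Prod>i\<in>A. 1 + t / a i)" using f by (rule prod_pos)
      then show ?thesis using k by (subst powr_realpow[symmetric]) (auto simp: powr_powr)
    qed
    ultimately show "(\<Prod>i\<in>A. 1 + t / a i) \<le> (1 + t * m) ^ n" by simp
  qed (use P in simp)
  also have "1 + t * m = real n / real k" using k m d by (simp add: t_def field_simps)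
  finally have E: "t ^ d * e \<le> P * (real n / real k) ^ n" .
  have td: "t ^ d * (real k ^ d * m ^ d) = real d ^ d"
    using k m by (simp add: t_def power_divide power_mult_distrib)
  have "e * (real k ^ k * real d ^ d) = (t ^ d * e) * (real k ^ n * m ^ d)"
    unfolding td[symmetric] d(2) by (simp add: power_add mult_ac)
  also have "\<dots> \<le> (P * (real n / real k) ^ n) * (real k ^ n * m ^ d)"
    using m by (intro mult_right_mono E) simp
  also have "\<dots> = P * m ^ d * real n ^ n" using k by (simp add: power_divide)
  also have "\<dots> \<le> P * m ^ d * ((real n + 1) * (real (n choose k) * real k ^ k * real d ^ d))"
  proof (rule mult_left_mono)
    have "real (n ^ n) \<le> real ((n + 1) * ((n choose k) * k ^ k * d ^ d))"
      unfolding d(2) using binomial_largest_term[of k d] by (simp only: of_nat_le_iff)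
    then show "real n ^ n \<le> (real n + 1) * (real (n choose k) * real k ^ k * real d ^ d)"
      by (simp add: algebra_simps)
  qed (use P m in simp)
  finally have "e * (real k ^ k * real d ^ d) \<le> ((real n + 1) * P * m ^ d * real (n choose k)) * (real k ^ k * real d ^ d)"
    by (simp add: mult_ac)
  then have "e \<le> (real n + 1) * P * m ^ d * real (n choose k)"
    using k d by (subst (asm) mult_le_cancel_right_pos) auto
  then show ?thesis
    using k unfolding e_def P_def d_def by (subst pos_divide_le_eq) auto
qed

lemma nat_ceiling_mult_over_tendsto:
  fixes c :: real
  assumes "0 < c"
  shows "(\<lambda>n. real (nat \<lceil>c * real n\<rceil>) / real n) \<longlonglongrightarrow> c"
proof (rule tendsto_sandwich)
  have b: "c * real n \<le> real (nat \<lceil>c * real n\<rceil>)" "real (nat \<lceil>c * real n\<rceil>) \<le> c * real n + 1" for n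
    using assms by (auto simp: of_nat_nat)
  show "\<forall>\<^sub>F n in sequentially. c \<le> real (nat \<lceil>c * real n\<rceil>) / real n"
    using eventually_gt_at_top[of 0] by eventually_elim (use b in \<open>simp add: pos_le_divide_eq\<close>)
  show "\<forall>\<^sub>F n in sequentially. real (nat \<lceil>c * real n\<rceil>) / real n \<le> c + 1 / real n"
    using eventually_gt_at_top[of 0]
    by eventually_elim (use b in \<open>simp add: pos_divide_le_eq distrib_right\<close>)
  show "(\<lambda>n. c + 1 / real n) \<longlonglongrightarrow> c"
    using tendsto_add[OF tendsto_const lim_1_over_n, of c] by simp
qed simp

text \<open>The deterministic half of the theorem: randomness enters only through the two limits
  \<open>l\<close> and \<open>q\<close>.\<close>

lemma elementary_symmetric_mean_limsup:
  fixes a :: "nat \<Rightarrow> real" and c l q :: real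
  defines "s \<equiv> \<lambda>n k. (\<Sum>I\<in>{I. I \<subseteq> {1..n} \<and> card I = k}. \<Prod>i\<in>I. a i) / real (n choose k)"
    and "\<kappa> \<equiv> \<lambda>n. nat \<lceil>c * real n\<rceil>"
  assumes pos: "\<And>i. 1 \<le> i \<Longrightarrow> 0 < a i" and c: "0 < c" "c < 1" and q: "0 < q"
    and liml: "(\<lambda>n. (\<Sum>i=1..n. ln (a i)) / real n) \<longlonglongrightarrow> l"
    and limq: "(\<lambda>n. (\<Sum>i=1..n. 1 / a i) / real n) \<longlonglongrightarrow> q"
  shows "ereal (exp l) \<le> limsup (\<lambda>n. ereal (s n (\<kappa> n) powr (1 / real (\<kappa> n))))"
    and "limsup (\<lambda>n. ereal (s n (\<kappa> n) powr (1 / real (\<kappa> n)))) \<le> ereal (exp l powr (1 / c) * q powr (1 / c - 1))"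
proof -
  define L where "L n = (\<Sum>i=1..n. ln (a i)) / real n" for n
  define Q where "Q n = (\<Sum>i=1..n. 1 / a i) / real n" for n
  define X where "X n = s n (\<kappa> n) powr (1 / real (\<kappa> n))" for n
  \<comment> \<open>The k-th root of the upper bound, rewritten in the ratio of
    \<open>\<kappa> n\<close> to \<open>n\<close> so that each ingredient is a sequence with a known
    limit. The first summand is what remains of the factor n + 1.\<close>
  define Y where "Y n = exp (ln (real n + 1) / real n / (real (\<kappa> n) / real n) + L n / (real (\<kappa> n) / real n)
      + (1 / (real (\<kappa> n) / real n) - 1) * ln (Q n))" for n
  have limL: "L \<longlonglongrightarrow> l" and limQ: "Q \<longlonglongrightarrow> q"
    using liml limq by (simp_all add: L_def[abs_def] Q_def[abs_def])
  have \<kappa>1: "\<forall>\<^sub>F n in sequentially. 1 \<le> \<kappa> n"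
    using eventually_gt_at_top[of 0] by eventually_elim (use c in \<open>simp add: \<kappa>_def Suc_le_eq\<close>)
  have lim\<kappa>: "(\<lambda>n. real (\<kappa> n) / real n) \<longlonglongrightarrow> c"
    unfolding \<kappa>_def by (rule nat_ceiling_mult_over_tendsto) fact
  have \<kappa>n: "\<forall>\<^sub>F n in sequentially. \<kappa> n < n"
    using order_tendstoD(2)[OF lim\<kappa> c(2)] eventually_gt_at_top[of 0]
    by eventually_elim simp
  have low: "\<forall>\<^sub>F n in sequentially. exp (L n) \<le> X n"
    using \<kappa>1 \<kappa>n
  proof eventually_elim
    case (elim n)
    have "exp (real (\<kappa> n) * L n) \<le> s n (\<kappa> n)"
      using elementary_symmetric_mean_ge[of "{1..n}" "\<kappa> n" a] elim pos by (simp add: s_def L_def)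
    then have "exp (real (\<kappa> n) * L n) powr (1 / real (\<kappa> n)) \<le> X n"
      unfolding X_def by (intro powr_mono2) auto
    then show ?case using elim by (simp add: powr_def)
  qed
  have up: "\<forall>\<^sub>F n in sequentially. X n \<le> Y n"
    using \<kappa>1 \<kappa>n
  proof eventually_elim
    case (elim n)
    let ?k = "\<kappa> n"
    have Q: "0 < Q n" unfolding Q_def using elim pos by (intro divide_pos_pos sum_pos) auto
    have prodexp: "(\<Prod>i=1..n. a i) = exp (real n * L n)"
    proof -
      have "(\<Prod>i=1..n. a i) = exp (\<Sum>i=1..n. ln (a i))"
        unfolding exp_sum[OF finite_atLeastAtMost] using pos by (intro prod.cong) auto
      then show ?thesis using elim by (simp add: L_def)
    qed
    have s0: "0 \<le> s n ?k"
      unfolding s_def using pos by (intro divide_nonneg_nonneg sum_nonneg prod_nonneg) (auto intro!: less_imp_le)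
    have "s n ?k \<le> (real n + 1) * exp (real n * L n) * Q n ^ (n - ?k)"
      using elementary_symmetric_mean_le[of "{1..n}" n ?k a] elim pos prodexp by (simp add: s_def Q_def)
    also have "\<dots> = exp (ln (real n + 1) + real n * L n + (real n - real ?k) * ln (Q n))"
      using Q elim by (simp add: exp_add exp_of_nat_mult flip: of_nat_diff)
    finally have "X n \<le> exp (ln (real n + 1) + real n * L n + (real n - real ?k) * ln (Q n)) powr (1 / real ?k)"
      unfolding X_def using s0 by (intro powr_mono2) auto
    also have "\<dots> = Y n"
      using elim by (simp add: powr_def Y_def add_divide_distrib diff_divide_distrib left_diff_distrib)
    finally show ?case .
  qed
  have "(\<lambda>n. ln (real n + 1) / real n) \<longlonglongrightarrow> 0" by real_asymp
  then have "Y \<longlonglongrightarrow> exp (0 / c + l / c + (1 / c - 1) * ln q)"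
    unfolding Y_def[abs_def] using c q by (intro tendsto_intros lim\<kappa> limL limQ) auto
  also have "exp (0 / c + l / c + (1 / c - 1) * ln q) = exp l powr (1 / c) * q powr (1 / c - 1)"
    using q by (simp add: powr_def exp_add)
  finally have limY: "limsup (\<lambda>n. ereal (Y n)) = ereal (exp l powr (1 / c) * q powr (1 / c - 1))"
    by (intro lim_imp_Limsup) auto
  have limE: "limsup (\<lambda>n. ereal (exp (L n))) = ereal (exp l)"
    using limL by (intro lim_imp_Limsup) (auto intro: tendsto_intros)
  show "ereal (exp l) \<le> limsup (\<lambda>n. ereal (s n (\<kappa> n) powr (1 / real (\<kappa> n))))"
    unfolding limE[symmetric] X_def[symmetric]
    by (rule Limsup_mono) (use low in simp)
  show "limsup (\<lambda>n. ereal (s n (\<kappa> n) powr (1 / real (\<kappa> n)))) \<le> ereal (exp l powr (1 / c) * q powr (1 / c - 1))"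
    unfolding limY[symmetric] X_def[symmetric]
    by (rule Limsup_mono) (use up in simp)
qed

section \<open>A law of large numbers\<close>

text \<open>With r = \<open>floor_sqrt n\<close>, monotonicity traps \<open>S n\<close> between its
  values at r^2 and (r+1)^2, and replacing n by either square changes the average by a factor
  tending to 1.\<close>

lemma averages_tendsto_from_squares:
  fixes S :: "nat \<Rightarrow> real"
  assumes mono: "mono S" and nonneg: "\<And>n. 0 \<le> S n"
    and lim: "(\<lambda>n. S (n\<^sup>2) / (real n)\<^sup>2) \<longlonglongrightarrow> m"
  shows "(\<lambda>n. S n / real n) \<longlonglongrightarrow> m"
proof -
  let ?r = "\<lambda>n. floor_sqrt n"
  have r: "filterlim ?r at_top sequentially"
    unfolding filterlim_at_top
  proof
    fix Z
    show "\<forall>\<^sub>F n in sequentially. Z \<le> ?r n"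
      using eventually_ge_at_top[of "Z\<^sup>2"] by eventually_elim (simp add: le_floor_sqrt_iff)
  qed
  have lim': "(\<lambda>n. S ((Suc n)\<^sup>2) / (real (Suc n))\<^sup>2) \<longlonglongrightarrow> m"
    using lim by (rule filterlim_compose[OF _ filterlim_Suc])
  have lo: "(\<lambda>n. S (n\<^sup>2) / (real n)\<^sup>2 * (real n / (real n + 1))\<^sup>2) \<longlonglongrightarrow> m * 1"
    by (intro tendsto_mult lim) real_asymp
  have hi: "(\<lambda>n. S ((Suc n)\<^sup>2) / (real (Suc n))\<^sup>2 * ((real n + 1) / real n)\<^sup>2) \<longlonglongrightarrow> m * 1"
    by (intro tendsto_mult lim') real_asymp
  show ?thesis
  proof (rule tendsto_sandwich)
    show "(\<lambda>n. S ((?r n)\<^sup>2) / (real (?r n))\<^sup>2 * (real (?r n) / (real (?r n) + 1))\<^sup>2) \<longlonglongrightarrow> m"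
      using filterlim_compose[OF lo r] by simp
    show "(\<lambda>n. S ((Suc (?r n))\<^sup>2) / (real (Suc (?r n)))\<^sup>2 * ((real (?r n) + 1) / real (?r n))\<^sup>2) \<longlonglongrightarrow> m"
      using filterlim_compose[OF hi r] by simp
    have R: "(?r n)\<^sup>2 \<le> n" "n \<le> (Suc (?r n))\<^sup>2" for n
      using Suc_floor_sqrt_power2_gt[of n] by (auto simp: less_imp_le)
    show "\<forall>\<^sub>F n in sequentially. S ((?r n)\<^sup>2) / (real (?r n))\<^sup>2 * (real (?r n) / (real (?r n) + 1))\<^sup>2 \<le> S n / real n"
      using eventually_gt_at_top[of 0]
    proof eventually_elim
      case (elim n)
      then have pos: "0 < ?r n" by simp
      have "real n \<le> real ((Suc (?r n))\<^sup>2)" using R(2) by (simp only: of_nat_le_iff)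
      then have n: "real n \<le> (real (?r n) + 1)\<^sup>2" by (simp add: add.commute)
      have "S ((?r n)\<^sup>2) / (real (?r n))\<^sup>2 * (real (?r n) / (real (?r n) + 1))\<^sup>2 = S ((?r n)\<^sup>2) / (real (?r n) + 1)\<^sup>2"
        using pos by (simp add: power_divide)
      also have "\<dots> \<le> S n / real n"
        using monoD[OF mono R(1)] n nonneg elim by (intro frac_le) auto
      finally show ?case .
    qed
    show "\<forall>\<^sub>F n in sequentially. S n / real n \<le> S ((Suc (?r n))\<^sup>2) / (real (Suc (?r n)))\<^sup>2 * ((real (?r n) + 1) / real (?r n))\<^sup>2"
      using eventually_gt_at_top[of 0]
    proof eventually_elim
      case (elim n)
      then have pos: "0 < ?r n" by simp
      have "real ((?r n)\<^sup>2) \<le> real n" using R(1) by (simp only: of_nat_le_iff)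
      then have n: "(real (?r n))\<^sup>2 \<le> real n" by simp
      have "S n / real n \<le> S ((Suc (?r n))\<^sup>2) / (real (?r n))\<^sup>2"
        using monoD[OF mono R(2)] n nonneg pos by (intro frac_le) auto
      also have "\<dots> = S ((Suc (?r n))\<^sup>2) / (real (Suc (?r n)))\<^sup>2 * ((real (?r n) + 1) / real (?r n))\<^sup>2"
        using pos by (simp add: power_divide add.commute)
      finally show ?case .
    qed
  qed
qed

text \<open>Applied to each side of the diagonal in a row of the covariance matrix, where the
  exponents are distinct lags.\<close>

lemma sum_power_inj_le:
  fixes \<theta> :: real
  assumes "finite A" "inj_on g A" "0 \<le> \<theta>" "\<theta> < 1"
  shows "(\<Sum>a\<in>A. \<theta> ^ g a) \<le> 1 / (1 - \<theta>)"
proof -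
  have "(\<Sum>a\<in>A. \<theta> ^ g a) = (\<Sum>d\<in>g ` A. \<theta> ^ d)"
    using assms(2) by (simp add: sum.reindex)
  also have "\<dots> \<le> (\<Sum>d. \<theta> ^ d)"
    using assms by (intro sum_le_suminf summable_geometric) auto
  also have "\<dots> = 1 / (1 - \<theta>)" using assms by (intro suminf_geometric) auto
  finally show ?thesis .
qed

context prob_space
begin

text \<open>Each row of the covariance matrix is dominated by two geometric series, one for each
  side (the diagonal goes with \<open>j \<le> i\<close>), so the variance grows at most linearly in
  n. Since only an upper bound is wanted, one-sided bounds on the covariances suffice.\<close>

lemma second_moment_centered_sum_le:
  fixes X :: "nat \<Rightarrow> 'a \<Rightarrow> real"
  assumes int: "\<And>i. integrable M (X i)" and int2: "\<And>i j. integrable M (\<lambda>w. X i w * X j w)"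
    and mean: "\<And>i. expectation (X i) = m"
    and cov: "\<And>i j. i \<le> j \<Longrightarrow> expectation (\<lambda>w. X i w * X j w) \<le> m\<^sup>2 + B * \<theta> ^ (j - i)"
    and B: "0 \<le> B" and \<theta>: "0 \<le> \<theta>" "\<theta> < 1"
  shows "integrable M (\<lambda>w. ((\<Sum>i<n. X i w) - real n * m)\<^sup>2)"
    and "expectation (\<lambda>w. ((\<Sum>i<n. X i w) - real n * m)\<^sup>2) \<le> real n * (2 * B / (1 - \<theta>))"
proof -
  have sq: "((\<Sum>i<n. X i w) - real n * m)\<^sup>2
      = (\<Sum>i<n. \<Sum>j<n. X i w * X j w) - 2 * real n * m * (\<Sum>i<n. X i w) + (real n * m)\<^sup>2" for w
    by (simp add: power2_diff sum_product[symmetric] power2_eq_square algebra_simps)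
  show "integrable M (\<lambda>w. ((\<Sum>i<n. X i w) - real n * m)\<^sup>2)"
    unfolding sq by (intro Bochner_Integration.integrable_add Bochner_Integration.integrable_diff
        integrable_mult_right Bochner_Integration.integrable_sum int int2) auto
  have row: "(\<Sum>j<n. expectation (\<lambda>w. X i w * X j w) - m\<^sup>2) \<le> 2 * B / (1 - \<theta>)" for i
  proof -
    have "expectation (\<lambda>w. X i w * X j w) - m\<^sup>2 \<le> B * (if j \<le> i then \<theta> ^ (i - j) else \<theta> ^ (j - i))" for j
      using cov[of i j] cov[of j i] by (auto simp: mult.commute)
    then have "(\<Sum>j<n. expectation (\<lambda>w. X i w * X j w) - m\<^sup>2)
        \<le> (\<Sum>j<n. B * (if j \<le> i then \<theta> ^ (i - j) else \<theta> ^ (j - i)))"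
      by (intro sum_mono) auto
    also have "\<dots> = B * ((\<Sum>j\<in>{..<n} \<inter> {j. j \<le> i}. \<theta> ^ (i - j)) + (\<Sum>j\<in>{..<n} \<inter> - {j. j \<le> i}. \<theta> ^ (j - i)))"
      by (simp add: sum_distrib_left[symmetric] sum.If_cases)
    also have "\<dots> \<le> B * (1 / (1 - \<theta>) + 1 / (1 - \<theta>))"
      using \<theta> B by (intro mult_left_mono add_mono sum_power_inj_le) (auto simp: inj_on_def)
    finally show ?thesis by (simp add: mult.commute)
  qed
  have "expectation (\<lambda>w. ((\<Sum>i<n. X i w) - real n * m)\<^sup>2)
      = (\<Sum>i<n. \<Sum>j<n. expectation (\<lambda>w. X i w * X j w)) - 2 * real n * m * (\<Sum>i<n. expectation (X i)) + (real n * m)\<^sup>2"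
    unfolding sq using int int2 by (simp add: prob_space)
  also have "\<dots> = (\<Sum>i<n. \<Sum>j<n. expectation (\<lambda>w. X i w * X j w) - m\<^sup>2)"
    by (simp add: mean sum_subtractf power2_eq_square algebra_simps)
  also have "\<dots> \<le> (\<Sum>i<n. 2 * B / (1 - \<theta>))" by (intro sum_mono row)
  finally show "expectation (\<lambda>w. ((\<Sum>i<n. X i w) - real n * m)\<^sup>2) \<le> real n * (2 * B / (1 - \<theta>))"
    by simp
qed

text \<open>Linear variance makes the mean square deviation of the average over n^2 terms O(1/n^2),
  which is summable; over n terms it would be O(1/n). Nonnegativity makes the partial sums monotone,
  which fills the gaps between squares.\<close>

theorem strong_law_exponential_correlations:
  fixes X :: "nat \<Rightarrow> 'a \<Rightarrow> real"
  assumes nonneg: "\<And>i w. 0 \<le> X i w"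
    and int: "\<And>i. integrable M (X i)" and int2: "\<And>i j. integrable M (\<lambda>w. X i w * X j w)"
    and mean: "\<And>i. expectation (X i) = m"
    and cov: "\<And>i j. i \<le> j \<Longrightarrow> expectation (\<lambda>w. X i w * X j w) \<le> m\<^sup>2 + B * \<theta> ^ (j - i)"
    and B: "0 \<le> B" and \<theta>: "0 \<le> \<theta>" "\<theta> < 1"
  shows "AE w in M. (\<lambda>n. (\<Sum>i<n. X i w) / real n) \<longlonglongrightarrow> m"
proof -
  define C where "C = 2 * B / (1 - \<theta>)"
  define D where "D n w = (((\<Sum>i<n\<^sup>2. X i w) - real (n\<^sup>2) * m) / (real n)\<^sup>2)\<^sup>2" for n w
  have [measurable]: "X i \<in> borel_measurable M" for i using int by (rule borel_measurable_integrable)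
  have D_meas[measurable]: "D n \<in> borel_measurable M" for n unfolding D_def by measurable
  have D0: "0 \<le> D n w" for n w by (simp add: D_def)
  have bound: "(\<integral>\<^sup>+w. ennreal (D n w) \<partial>M) \<le> ennreal (C * (1 / (real n)\<^sup>2))" for n
  \<comment> \<open>For \<open>n = 0\<close> both sides are 0, because division by zero yields
    0.\<close>
  proof (cases "n = 0")
    case False
    note sm = second_moment_centered_sum_le[OF int int2 mean cov B \<theta>, of "n\<^sup>2"]
    have D: "D n w = ((\<Sum>i<n\<^sup>2. X i w) - real (n\<^sup>2) * m)\<^sup>2 / ((real n)\<^sup>2)\<^sup>2" for w
      by (simp add: D_def power_divide)
    have "(\<integral>\<^sup>+w. ennreal (D n w) \<partial>M) = ennreal (expectation (D n))"
      unfolding D by (intro nn_integral_eq_integral integrable_divide sm) auto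
    also have "expectation (D n) \<le> (real (n\<^sup>2) * C) / ((real n)\<^sup>2)\<^sup>2"
      unfolding D C_def by (subst integral_divide_zero) (intro divide_right_mono sm, auto)
    then have "ennreal (expectation (D n)) \<le> ennreal (C * (1 / (real n)\<^sup>2))"
      using False by (intro ennreal_leI) (simp add: power2_eq_square)
    finally show ?thesis .
  qed (simp add: D_def)
  \<comment> \<open>A finite expectation of the whole series gives almost sure convergence of its
    terms to 0 directly, in place of Chebyshev with Borel-Cantelli.\<close>
  have "(\<integral>\<^sup>+w. (\<Sum>n. ennreal (D n w)) \<partial>M) = (\<Sum>n. \<integral>\<^sup>+w. ennreal (D n w) \<partial>M)"
    by (intro nn_integral_suminf) measurable
  also have "\<dots> \<le> (\<Sum>n. ennreal (C * (1 / (real n)\<^sup>2)))"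
    by (intro suminf_le bound) auto
  also have "\<dots> < \<infinity>"
  proof -
    have "summable (\<lambda>n. C * (1 / (real n)\<^sup>2))"
      using inverse_power_summable[of 2, where 'a=real]
      by (intro summable_mult) (simp add: inverse_eq_divide)
    then show ?thesis
      using B \<theta> by (subst suminf_ennreal2) (auto simp: C_def)
  qed
  finally have "AE w in M. (\<Sum>n. ennreal (D n w)) \<noteq> \<infinity>"
    by (intro nn_integral_PInf_AE) auto
  then show ?thesis
  proof eventually_elim
    case (elim w)
    have "summable (\<lambda>n. D n w)"
      using elim D0 by (intro summable_suminf_not_top) auto
    then have "(\<lambda>n. D n w) \<longlonglongrightarrow> 0" by (rule summable_LIMSEQ_zero)
    then have "(\<lambda>n. ((\<Sum>i<n\<^sup>2. X i w) - real (n\<^sup>2) * m) / (real n)\<^sup>2) \<longlonglongrightarrow> 0"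
      unfolding D_def by (subst (asm) power_tendsto_0_iff) simp_all
    then have "(\<lambda>n. ((\<Sum>i<n\<^sup>2. X i w) - real (n\<^sup>2) * m) / (real n)\<^sup>2 + m) \<longlonglongrightarrow> 0 + m"
      by (intro tendsto_intros)
    moreover have "\<forall>\<^sub>F n in sequentially. ((\<Sum>i<n\<^sup>2. X i w) - real (n\<^sup>2) * m) / (real n)\<^sup>2 + m = (\<Sum>i<n\<^sup>2. X i w) / (real n)\<^sup>2"
      using eventually_gt_at_top[of 0] by eventually_elim (simp add: field_simps)
    ultimately have "(\<lambda>n. (\<Sum>i<n\<^sup>2. X i w) / (real n)\<^sup>2) \<longlonglongrightarrow> m"
      by (simp add: tendsto_cong)
    then show ?case
      using nonneg by (intro averages_tendsto_from_squares) (auto intro!: monoI sum_mono2 sum_nonneg)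
  qed
qed

end

section \<open>The Gauss map and its transfer operator\<close>

text \<open>
  The index \<open>r\<close> belongs to the branch of the Gauss map with digit \<open>r + 1\<close>. The weights are those of
  the transfer operator with respect to the invariant density \<open>1 / (ln 2 * (1 + x))\<close>.
\<close>

definition gauss_weight :: "nat \<Rightarrow> real \<Rightarrow> real" where
  "gauss_weight r x = (1 + x) / ((real r + 1 + x) * (real r + 2 + x))"

definition gauss_branch :: "nat \<Rightarrow> real \<Rightarrow> real" where
  "gauss_branch r x = 1 / (real r + 1 + x)"

definition gauss_transfer :: "(real \<Rightarrow> real) \<Rightarrow> real \<Rightarrow> real" where
  "gauss_transfer g x = (\<Sum>r. gauss_weight r x * g (gauss_branch r x))"

text \<open>Closed form, for x in (0,1), of the sum of \<open>gauss_weight s x\<close> over all s >=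
  r.\<close>

definition gauss_tail :: "nat \<Rightarrow> real \<Rightarrow> real" where
  "gauss_tail r x = (1 + x) / (real r + 1 + x)"

lemma gauss_branch_in_unit: "x \<in> {0<..<1} \<Longrightarrow> gauss_branch r x \<in> {0<..<1}"
  by (simp add: gauss_branch_def)

lemma gauss_weight_nonneg: "x \<in> {0<..<1} \<Longrightarrow> 0 \<le> gauss_weight r x"
  by (auto simp: gauss_weight_def)

lemma gauss_weight_eq_tail_diff:
  assumes "x \<in> {0<..<1}"
  shows "gauss_weight r x = gauss_tail r x - gauss_tail (Suc r) x"
proof -
  have "(1 + x) / (a * (a + 1)) = (1 + x) / a - (1 + x) / (a + 1)" if "0 < a" for a
    using that by (simp add: diff_frac_eq) (simp add: algebra_simps)
  from this[of "real r + 1 + x"] show ?thesis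
    using assms by (simp add: gauss_weight_def gauss_tail_def add_ac)
qed

lemma gauss_weight_sums:
  assumes "x \<in> {0<..<1}"
  shows "(\<lambda>r. gauss_weight r x) sums 1"
proof -
  have "(\<lambda>r. gauss_tail r x) \<longlonglongrightarrow> 0"
    unfolding gauss_tail_def by real_asymp
  then have "(\<lambda>r. gauss_tail r x - gauss_tail (Suc r) x) sums (gauss_tail 0 x - 0)"
    by (rule telescope_sums')
  then show ?thesis
    using assms by (simp add: gauss_weight_eq_tail_diff gauss_tail_def)
qed

lemma gauss_tail_diff:
  assumes "x \<in> {0<..<1}" "y \<in> {0<..<1}"
  shows "gauss_tail r x - gauss_tail r y = (x - y) * (real r / ((real r + 1 + x) * (real r + 1 + y)))"
proof -
  have "(1 + x) / (real r + 1 + x) - (1 + y) / (real r + 1 + y)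
      = ((1 + x) * (real r + 1 + y) - (1 + y) * (real r + 1 + x)) / ((real r + 1 + x) * (real r + 1 + y))"
    using assms by (intro diff_frac_eq) auto
  also have "(1 + x) * (real r + 1 + y) - (1 + y) * (real r + 1 + x) = (x - y) * real r"
    by (simp add: algebra_simps)
  finally show ?thesis by (simp add: gauss_tail_def)
qed

text \<open>The tail differences decay only like 1/r, so the extra power must come from subtracting
  neighbours: r/a - (r+1)/b = r(b - a)/(ab) - 1/b. The two parts contribute 2 and 1 to the constant
  3.\<close>

lemma gauss_weight_diff_le:
  assumes "x \<in> {0<..<1}" "y \<in> {0<..<1}"
  shows "\<bar>gauss_weight r x - gauss_weight r y\<bar> \<le> 3 / (real r + 1)\<^sup>2 * \<bar>x - y\<bar>"
proof -
  define a where "a = (real r + 1 + x) * (real r + 1 + y)"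
  define b where "b = (real r + 2 + x) * (real r + 2 + y)"
  have a: "(real r + 1)\<^sup>2 \<le> a" unfolding a_def power2_eq_square using assms by (intro mult_mono) auto
  have b: "(real r + 2)\<^sup>2 \<le> b" unfolding b_def power2_eq_square using assms by (intro mult_mono) auto
  have a0: "0 < a" using assms by (simp add: a_def)
  have b0: "0 < b" using assms by (simp add: b_def)
  have "gauss_weight r x - gauss_weight r y = (x - y) * (real r / a - (real r + 1) / b)"
    using gauss_tail_diff[OF assms, of r] gauss_tail_diff[OF assms, of "Suc r"] assms
    by (simp add: gauss_weight_eq_tail_diff a_def b_def right_diff_distrib add.commute add.left_commute)
  moreover have "\<bar>real r / a - (real r + 1) / b\<bar> \<le> 3 / (real r + 1)\<^sup>2"
  proof -
    have "real r / a - (real r + 1) / b = real r * (2 * real r + 3 + x + y) / (a * b) - 1 / b"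
    proof -
      have e: "2 * real r + 3 + x + y = b - a" by (simp add: a_def b_def algebra_simps)
      show ?thesis unfolding e using a0 b0 by (simp add: field_simps)
    qed
    also have "\<bar>\<dots>\<bar> \<le> \<bar>real r * (2 * real r + 3 + x + y) / (a * b)\<bar> + \<bar>1 / b\<bar>"
      by (rule abs_triangle_ineq4)
    also have "\<dots> = real r * (2 * real r + 3 + x + y) / (a * b) + 1 / b"
      using a0 b0 assms by simp
    also have "\<dots> \<le> 2 / (real r + 1)\<^sup>2 + 1 / (real r + 1)\<^sup>2"
    proof (rule add_mono)
      have "real r * (2 * real r + 3 + x + y) \<le> real r * (2 * real r + 5)"
        using assms by (intro mult_left_mono) auto
      also have "\<dots> \<le> 2 * (real r + 2)\<^sup>2" by (simp add: power2_eq_square algebra_simps)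
      also have "\<dots> \<le> 2 * b" using b by simp
      finally have "real r * (2 * real r + 3 + x + y) / (a * b) \<le> (2 * b) / (a * b)"
        using a0 b0 by (intro divide_right_mono) auto
      also have "\<dots> = 2 / a" using b0 by simp
      also have "\<dots> \<le> 2 / (real r + 1)\<^sup>2" using a a0 by (intro divide_left_mono) auto
      finally show "real r * (2 * real r + 3 + x + y) / (a * b) \<le> 2 / (real r + 1)\<^sup>2" .
      have "(real r + 1)\<^sup>2 \<le> (real r + 2)\<^sup>2" by (intro power_mono) auto
      with b have "(real r + 1)\<^sup>2 \<le> b" by linarith
      then show "1 / b \<le> 1 / (real r + 1)\<^sup>2" using b0 by (intro divide_left_mono) auto
    qed
    finally show ?thesis by simp
  qed
  ultimately have "\<bar>gauss_weight r x - gauss_weight r y\<bar> \<le> \<bar>x - y\<bar> * (3 / (real r + 1)\<^sup>2)"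
    by (simp only: abs_mult) (intro mult_left_mono abs_ge_zero)
  then show ?thesis by (simp only: mult.commute)
qed

text \<open>The digit is constant on each branch, so this series is the transfer operator applied to
  a function of the first digit. It is Lipschitz even for unbounded \<open>f\<close>, provided the
  growth of \<open>f\<close> is moderate.\<close>

lemma lipschitz_on_gauss_weight_series:
  assumes sum: "summable (\<lambda>r. \<bar>f r\<bar> / (real r + 1)\<^sup>2)"
    and sumw: "\<And>x. x \<in> {0<..<1} \<Longrightarrow> summable (\<lambda>r. gauss_weight r x * f r)"
  shows "(3 * (\<Sum>r. \<bar>f r\<bar> / (real r + 1)\<^sup>2))-lipschitz_on {0<..<1} (\<lambda>x. \<Sum>r. gauss_weight r x * f r)"
proof (rule lipschitz_onI)
  fix x y :: real
  assume xy: "x \<in> {0<..<1}" "y \<in> {0<..<1}"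
  have termwise: "norm (gauss_weight r x * f r - gauss_weight r y * f r) \<le> 3 * \<bar>x - y\<bar> * (\<bar>f r\<bar> / (real r + 1)\<^sup>2)" for r
  proof -
    have "norm (gauss_weight r x * f r - gauss_weight r y * f r) = \<bar>gauss_weight r x - gauss_weight r y\<bar> * \<bar>f r\<bar>"
      by (simp add: abs_mult flip: left_diff_distrib)
    also have "\<dots> \<le> (3 / (real r + 1)\<^sup>2 * \<bar>x - y\<bar>) * \<bar>f r\<bar>"
      by (intro mult_right_mono gauss_weight_diff_le xy) auto
    finally show ?thesis by (simp add: mult_ac)
  qed
  have "norm (\<Sum>r. gauss_weight r x * f r - gauss_weight r y * f r) \<le> (\<Sum>r. 3 * \<bar>x - y\<bar> * (\<bar>f r\<bar> / (real r + 1)\<^sup>2))"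
    by (intro norm_suminf_le summable_mult sum) (use termwise in auto)
  also have "(\<Sum>r. 3 * \<bar>x - y\<bar> * (\<bar>f r\<bar> / (real r + 1)\<^sup>2)) = 3 * (\<Sum>r. \<bar>f r\<bar> / (real r + 1)\<^sup>2) * dist x y"
    unfolding suminf_mult[OF sum] dist_real_def by simp
  finally show "dist (\<Sum>r. gauss_weight r x * f r) (\<Sum>r. gauss_weight r y * f r)
      \<le> 3 * (\<Sum>r. \<bar>f r\<bar> / (real r + 1)\<^sup>2) * dist x y"
    unfolding dist_norm suminf_diff[OF sumw[OF xy(1)] sumw[OF xy(2)]] .
qed (use sum in \<open>auto intro: suminf_nonneg\<close>)

section \<open>Contraction of Lipschitz constants\<close>

lemma lipschitz_on_unit_bounded:
  fixes g :: "real \<Rightarrow> real"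
  assumes "L-lipschitz_on {0<..<1} g" "x \<in> {0<..<1}"
  shows "\<bar>g x\<bar> \<le> \<bar>g (1/2)\<bar> + L"
proof -
  have "dist (g x) (g (1/2)) \<le> L * dist x (1/2)"
    using assms by (intro lipschitz_onD) auto
  also have "\<dots> \<le> L * 1"
    using assms lipschitz_on_nonneg[OF assms(1)] by (intro mult_left_mono) (auto simp: dist_real_def)
  finally show ?thesis by (simp add: dist_real_def)
qed

text \<open>Weights and branches are evaluated at separate points because the contraction estimate
  moves them one at a time.\<close>

lemma summable_gauss_transfer:
  assumes "L-lipschitz_on {0<..<1} g" "x \<in> {0<..<1}" "y \<in> {0<..<1}"
  shows "summable (\<lambda>r. gauss_weight r x * g (gauss_branch r y))"
proof (rule summable_comparison_test')
  show "summable (\<lambda>r. gauss_weight r x * (\<bar>g (1/2)\<bar> + L))"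
    by (intro summable_mult2 sums_summable[OF gauss_weight_sums] assms)
  fix r
  show "norm (gauss_weight r x * g (gauss_branch r y)) \<le> gauss_weight r x * (\<bar>g (1/2)\<bar> + L)"
    using gauss_weight_nonneg[OF assms(2)] lipschitz_on_unit_bounded[OF assms(1) gauss_branch_in_unit[OF assms(3)]]
    by (simp add: abs_mult mult_left_mono)
qed

lemma sum_by_parts:
  fixes d G :: "nat \<Rightarrow> real"
  shows "(\<Sum>r<N. (d r - d (Suc r)) * G r) = d 0 * G 0 - d N * G N + (\<Sum>r<N. d (Suc r) * (G (Suc r) - G r))"
  by (induction N) (simp_all add: algebra_simps)

text \<open>Compare with 1/((r+1)(r+2)(r+3)), whose sum telescopes to 1/4.\<close>

lemma sum_inverse_cubes_le: "(\<Sum>r<N. 1 / (real r + 2) ^ 3) \<le> 1 / 4"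
proof -
  have "(\<Sum>r<N. 1 / (real r + 2) ^ 3) \<le> 1 / 4 - 1 / (2 * (real N + 1) * (real N + 2))"
  proof (induction N)
    case (Suc N)
    have "1 / (real N + 2) ^ 3 \<le> 1 / (2 * (real N + 1) * (real N + 2)) - 1 / (2 * (real N + 2) * (real N + 3))"
      by (simp add: divide_simps) (simp add: algebra_simps power3_eq_cube)
    with Suc show ?case by (simp add: algebra_simps)
  qed simp
  moreover have "0 \<le> 1 / (2 * (real N + 1) * (real N + 2))" by simp
  ultimately show ?thesis by linarith
qed

text \<open>An average of the branch derivatives. All branches except the first have derivative at
  most 1/4 in absolute value; the first exceeds 1/4 by at most 3/4 and has weight 1/(2+x) <= 1/2.
  This gives 1/4 + 3/8 = 5/8.\<close>

lemma gauss_weight_over_square_sum_le: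
  assumes x: "x \<in> {0<..<1}"
  shows "summable (\<lambda>r. gauss_weight r x / (real r + 1 + x)\<^sup>2)"
    and "(\<Sum>r. gauss_weight r x / (real r + 1 + x)\<^sup>2) \<le> 5 / 8"
proof -
  have le: "gauss_weight r x / (real r + 1 + x)\<^sup>2 \<le> gauss_weight r x / 4 + (if r = 0 then 3 / 8 else 0)" for r
  proof (cases "r = 0")
    case True
    have "gauss_weight 0 x = 1 / (2 + x)" using x by (auto simp: gauss_weight_def)
    moreover have "1 / (2 + x) \<le> 1 / 2" using x by auto
    moreover have "1 / (1 + x)\<^sup>2 \<le> 1" using x by (simp add: divide_le_eq_1 one_le_power)
    moreover have "1 / 2\<^sup>2 \<le> 1 / (1 + x)\<^sup>2" using x by (intro divide_left_mono power_mono) auto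
    ultimately have "gauss_weight 0 x * (1 / (1 + x)\<^sup>2 - 1/4) \<le> 1 / 2 * (3 / 4)"
      by (intro mult_mono) auto
    then have "gauss_weight 0 x * (1 / (1 + x)\<^sup>2) \<le> gauss_weight 0 x / 4 + 3 / 8"
      unfolding right_diff_distrib by linarith
    with True show ?thesis by simp
  next
    case False
    then have "2\<^sup>2 \<le> (real r + 1 + x)\<^sup>2" using x by (intro power_mono) auto
    then have "gauss_weight r x / (real r + 1 + x)\<^sup>2 \<le> gauss_weight r x / 2\<^sup>2"
      using gauss_weight_nonneg[OF x, of r] x by (intro divide_left_mono) auto
    with False show ?thesis by simp
  qed
  have S: "(\<lambda>r. gauss_weight r x / 4 + (if r = 0 then 3 / 8 else 0)) sums (1 / 4 + 3 / 8)"
    by (intro sums_add sums_divide gauss_weight_sums x sums_single)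
  show sm: "summable (\<lambda>r. gauss_weight r x / (real r + 1 + x)\<^sup>2)"
    by (rule summable_comparison_test'[OF sums_summable[OF S], of 0])
      (use le gauss_weight_nonneg[OF x] in simp)
  have "(\<Sum>r. gauss_weight r x / (real r + 1 + x)\<^sup>2) \<le> (1 / 4 + 3 / 8)"
    using suminf_le[OF le sm sums_summable[OF S]] sums_unique[OF S] by simp
  then show "(\<Sum>r. gauss_weight r x / (real r + 1 + x)\<^sup>2) \<le> 5 / 8" by simp
qed

text \<open>The difference splits into \<open>A\<close>, with the weights frozen at
  \<open>x\<close>, and \<open>B\<close>, with the branches frozen at \<open>y\<close>.
  \<open>A\<close> is controlled by the averaged branch derivative, \<open>B\<close> by the fact
  that consecutive branches are close together, so that both bounds are multiples of
  \<open>L\<close> alone.\<close>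

lemma lipschitz_on_gauss_transfer:
  assumes g: "L-lipschitz_on {0<..<1} g"
  shows "(7 / 8 * L)-lipschitz_on {0<..<1} (gauss_transfer g)"
proof (rule lipschitz_on_leI)
  have L: "0 \<le> L" using g by (rule lipschitz_on_nonneg)
  then show "0 \<le> 7 / 8 * L" by simp
  fix x y :: real
  assume x: "x \<in> {0<..<1}" and y: "y \<in> {0<..<1}" and xy: "x \<le> y"
  let ?p = gauss_weight and ?u = gauss_branch
  define A where "A = (\<Sum>r. ?p r x * (g (?u r x) - g (?u r y)))"
  define B where "B = (\<Sum>r. (?p r x - ?p r y) * g (?u r y))"
  have sA: "summable (\<lambda>r. ?p r x * (g (?u r x) - g (?u r y)))"
    using summable_diff[OF summable_gauss_transfer[OF g x x] summable_gauss_transfer[OF g x y]]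
    by (simp add: algebra_simps)
  have sB: "summable (\<lambda>r. (?p r x - ?p r y) * g (?u r y))"
    using summable_diff[OF summable_gauss_transfer[OF g x y] summable_gauss_transfer[OF g y y]]
    by (simp add: algebra_simps)
  have "gauss_transfer g x - gauss_transfer g y = A + B"
    unfolding gauss_transfer_def A_def B_def suminf_add[OF sA sB]
    by (subst suminf_diff[OF summable_gauss_transfer[OF g x x] summable_gauss_transfer[OF g y y]])
      (simp add: algebra_simps)
  moreover have "\<bar>A\<bar> \<le> L * (y - x) * (5 / 8)"
  proof -
    have le: "norm (?p r x * (g (?u r x) - g (?u r y))) \<le> L * (y - x) * (?p r x / (real r + 1 + x)\<^sup>2)" for r
    proof -
      have "dist (g (?u r x)) (g (?u r y)) \<le> L * dist (?u r x) (?u r y)"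
        by (intro lipschitz_onD[OF g] gauss_branch_in_unit x y)
      also have "dist (?u r x) (?u r y) = (y - x) / ((real r + 1 + x) * (real r + 1 + y))"
      proof -
        have "?u r x - ?u r y = (y - x) / ((real r + 1 + x) * (real r + 1 + y))"
          unfolding gauss_branch_def using x y by (subst diff_frac_eq) auto
        then show ?thesis using x y xy by (simp add: dist_real_def)
      qed
      \<comment> \<open>Here \<open>x \<le> y\<close> is used: the bound then depends on
        \<open>x\<close> alone, the point at which the weights of \<open>A\<close> are
        taken.\<close>
      also have "\<dots> \<le> (y - x) / (real r + 1 + x)\<^sup>2"
        unfolding power2_eq_square using x y xy by (intro divide_left_mono mult_left_mono) auto
      finally have "\<bar>g (?u r x) - g (?u r y)\<bar> \<le> L * ((y - x) / (real r + 1 + x)\<^sup>2)"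
        using L by (simp add: dist_real_def mult_left_mono)
      then have "?p r x * \<bar>g (?u r x) - g (?u r y)\<bar> \<le> ?p r x * (L * ((y - x) / (real r + 1 + x)\<^sup>2))"
        by (intro mult_left_mono gauss_weight_nonneg x)
      then show ?thesis using gauss_weight_nonneg[OF x, of r] by (simp add: abs_mult mult_ac)
    qed
    have "norm A \<le> (\<Sum>r. L * (y - x) * (?p r x / (real r + 1 + x)\<^sup>2))"
      unfolding A_def
      by (intro norm_suminf_le summable_mult gauss_weight_over_square_sum_le x) (use le in auto)
    also have "\<dots> = L * (y - x) * (\<Sum>r. ?p r x / (real r + 1 + x)\<^sup>2)"
      by (intro suminf_mult gauss_weight_over_square_sum_le x)
    also have "\<dots> \<le> L * (y - x) * (5 / 8)"
      using L xy by (intro mult_left_mono gauss_weight_over_square_sum_le x) auto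
    finally show ?thesis by simp
  qed
  \<comment> \<open>Summation by parts puts the differences onto the tails of the weights, whose \<open>x\<close>-dependence is explicit.\<close>
  moreover have "\<bar>B\<bar> \<le> L * (y - x) * (1 / 4)"
  proof (rule LIMSEQ_le)
    define d where "d r = gauss_tail r x - gauss_tail r y" for r
    define G where "G r = g (?u r y)" for r
    define M where "M = \<bar>g (1/2)\<bar> + L"
    have M: "\<bar>G r\<bar> \<le> M" for r
      unfolding M_def G_def by (intro lipschitz_on_unit_bounded[OF g] gauss_branch_in_unit y)
    have "(\<lambda>N. \<Sum>r<N. (?p r x - ?p r y) * G r) \<longlonglongrightarrow> B"
      unfolding B_def G_def by (rule summable_LIMSEQ[OF sB])
    then show "(\<lambda>N. \<bar>\<Sum>r<N. (?p r x - ?p r y) * G r\<bar>) \<longlonglongrightarrow> \<bar>B\<bar>" by (rule tendsto_rabs)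
    \<comment> \<open>This decays only like 1/r; the step between consecutive branches in
      \<open>lip\<close> supplies 1/r^2, and the product is the summable inverse cube.\<close>
    have d_abs: "\<bar>d r\<bar> \<le> (y - x) * (real r / (real r + 1)\<^sup>2)" for r
    proof -
      have "\<bar>d r\<bar> = (y - x) * (real r / ((real r + 1 + x) * (real r + 1 + y)))"
        unfolding d_def gauss_tail_diff[OF x y] using x y xy by (simp add: abs_mult)
      also have "\<dots> \<le> (y - x) * (real r / (real r + 1)\<^sup>2)"
        unfolding power2_eq_square using x y xy
        by (intro mult_left_mono divide_left_mono mult_mono) auto
      finally show ?thesis .
    qed
    have lip: "\<bar>G (Suc r) - G r\<bar> \<le> L * (1 / ((real r + 1) * (real r + 2)))" for r
    proof -
      have "dist (G (Suc r)) (G r) \<le> L * dist (?u (Suc r) y) (?u r y)"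
        unfolding G_def by (intro lipschitz_onD[OF g] gauss_branch_in_unit y)
      also have "dist (?u (Suc r) y) (?u r y) = 1 / ((real r + 1 + y) * (real r + 2 + y))"
      proof -
        have "?u r y - ?u (Suc r) y = 1 / ((real r + 1 + y) * (real r + 2 + y))"
          unfolding gauss_branch_def using y by (subst diff_frac_eq) (auto simp: add_ac)
        then show ?thesis using y by (simp add: dist_real_def abs_minus_commute)
      qed
      also have "\<dots> \<le> 1 / ((real r + 1) * (real r + 2))"
        using y by (intro divide_left_mono mult_mono) auto
      finally show ?thesis using L by (simp add: dist_real_def mult_left_mono)
    qed
    \<comment> \<open>The lower boundary term vanishes because the full weight sum is 1 at both
      points; the upper one is O(1/N), since \<open>G\<close> is bounded, and disappears in the
      limit.\<close>
    have "\<bar>\<Sum>r<N. (?p r x - ?p r y) * G r\<bar> \<le> (y - x) * (real N / (real N + 1)\<^sup>2) * M + L * (y - x) * (1 / 4)" for N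
    proof -
      have "(\<Sum>r<N. (?p r x - ?p r y) * G r) = (\<Sum>r<N. (d r - d (Suc r)) * G r)"
        unfolding d_def using x y by (simp add: gauss_weight_eq_tail_diff algebra_simps)
      also have "\<dots> = - d N * G N + (\<Sum>r<N. d (Suc r) * (G (Suc r) - G r))"
      proof -
        have "d 0 = 0" using x y by (simp add: d_def gauss_tail_def)
        then show ?thesis unfolding sum_by_parts by simp
      qed
      also have "\<bar>\<dots>\<bar> \<le> \<bar>d N\<bar> * \<bar>G N\<bar> + (\<Sum>r<N. \<bar>d (Suc r)\<bar> * \<bar>G (Suc r) - G r\<bar>)"
        unfolding abs_mult[symmetric]
        by (rule order_trans[OF abs_triangle_ineq]) (simp add: abs_mult[symmetric])
      also have "\<dots> \<le> (y - x) * (real N / (real N + 1)\<^sup>2) * M + (\<Sum>r<N. L * (y - x) * (1 / (real r + 2) ^ 3))"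
      proof (intro add_mono sum_mono)
        show "\<bar>d N\<bar> * \<bar>G N\<bar> \<le> (y - x) * (real N / (real N + 1)\<^sup>2) * M"
          using xy by (intro mult_mono d_abs M) auto
        fix r
        have "\<bar>d (Suc r)\<bar> * \<bar>G (Suc r) - G r\<bar>
            \<le> ((y - x) * ((real r + 1) / (real r + 2)\<^sup>2)) * (L * (1 / ((real r + 1) * (real r + 2))))"
          using xy d_abs[of "Suc r"] by (intro mult_mono lip) (auto simp: add.commute)
        also have "\<dots> = L * (y - x) * (1 / (real r + 2) ^ 3)"
          by (simp add: power2_eq_square power3_eq_cube mult_ac)
        finally show "\<bar>d (Suc r)\<bar> * \<bar>G (Suc r) - G r\<bar> \<le> L * (y - x) * (1 / (real r + 2) ^ 3)" .
      qed
      also have "(\<Sum>r<N. L * (y - x) * (1 / (real r + 2) ^ 3)) \<le> L * (y - x) * (1 / 4)"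
        unfolding sum_distrib_left[symmetric] using L xy by (intro mult_left_mono sum_inverse_cubes_le) auto
      finally show ?thesis by simp
    qed
    then show "\<exists>N. \<forall>n\<ge>N. \<bar>\<Sum>r<n. (?p r x - ?p r y) * G r\<bar>
        \<le> (y - x) * (real n / (real n + 1)\<^sup>2) * M + L * (y - x) * (1 / 4)" by blast
    have "(\<lambda>n. real n / (real n + 1)\<^sup>2) \<longlonglongrightarrow> 0" by real_asymp
    then have "(\<lambda>n. (y - x) * (real n / (real n + 1)\<^sup>2) * M + L * (y - x) * (1 / 4)) \<longlonglongrightarrow> (y - x) * 0 * M + L * (y - x) * (1 / 4)"
      by (intro tendsto_intros)
    then show "(\<lambda>n. (y - x) * (real n / (real n + 1)\<^sup>2) * M + L * (y - x) * (1 / 4)) \<longlonglongrightarrow> L * (y - x) * (1 / 4)"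
      by simp
  qed
  ultimately have "\<bar>gauss_transfer g x - gauss_transfer g y\<bar> \<le> L * (y - x) * (5 / 8) + L * (y - x) * (1 / 4)"
    by linarith
  then show "dist (gauss_transfer g x) (gauss_transfer g y) \<le> 7 / 8 * L * dist x y"
    using xy by (simp add: dist_real_def)
qed

section \<open>The invariant measure and its duality with the transfer operator\<close>

definition gauss_density :: "real \<Rightarrow> real" where
  "gauss_density x = indicator {0<..<1} x / (ln 2 * (1 + x))"

definition gauss_measure :: "real measure" where
  "gauss_measure = density lborel (\<lambda>x. ennreal (gauss_density x))"

lemma gauss_density_measurable [measurable]: "gauss_density \<in> borel_measurable borel"
  unfolding gauss_density_def by measurable

lemma gauss_density_nonneg [simp]: "0 \<le> gauss_density x"
  by (auto simp: gauss_density_def indicator_def)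

lemma sets_gauss_measure [simp, measurable_cong]: "sets gauss_measure = sets borel"
  and space_gauss_measure [simp]: "space gauss_measure = UNIV"
  by (simp_all add: gauss_measure_def)

lemma gauss_map_measurable [measurable]: "gauss_map \<in> borel_measurable borel"
  unfolding gauss_map_def frac_def by measurable

lemma gauss_map_funpow_measurable [measurable]: "(gauss_map ^^ n) \<in> borel_measurable borel"
  by (induction n) auto

lemma gauss_weight_measurable [measurable]: "gauss_weight r \<in> borel_measurable borel"
  unfolding gauss_weight_def by measurable

lemma gauss_branch_measurable [measurable]: "gauss_branch r \<in> borel_measurable borel"
  unfolding gauss_branch_def by measurable

lemma gauss_transfer_measurable [measurable]:
  assumes [measurable]: "g \<in> borel_measurable borel"
  shows "gauss_transfer g \<in> borel_measurable borel"
  unfolding gauss_transfer_def by measurable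

lemma nn_integral_gauss_measure:
  assumes "f \<in> borel_measurable borel"
  shows "(\<integral>\<^sup>+x. f x \<partial>gauss_measure) = (\<integral>\<^sup>+x. ennreal (gauss_density x) * f x \<partial>lborel)"
  unfolding gauss_measure_def using assms by (subst nn_integral_density) auto

text \<open>The density is positive exactly on (0,1), so null sets there are the Lebesgue ones; this
  carries the final result back to Lebesgue measure.\<close>

lemma AE_gauss_measure_iff:
  assumes "Measurable.pred borel P"
  shows "(AE x in gauss_measure. P x) \<longleftrightarrow> (AE x in lborel. x \<in> {0<..<1} \<longrightarrow> P x)"
proof -
  have "0 < ennreal (gauss_density x) \<longleftrightarrow> x \<in> {0<..<1}" for x
    by (auto simp: gauss_density_def indicator_def)
  then show ?thesis
    unfolding gauss_measure_def using assms by (subst AE_density) auto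
qed

lemma AE_gauss_measure_unit: "AE x in gauss_measure. x \<in> {0<..<1}"
  by (subst AE_gauss_measure_iff) auto

lemma nn_integral_unit_FTC:
  fixes f F :: "real \<Rightarrow> real"
  assumes "f \<in> borel_measurable borel"
    and "\<And>x. x \<in> {0..1} \<Longrightarrow> (F has_real_derivative f x) (at x)" and "\<And>x. x \<in> {0..1} \<Longrightarrow> 0 \<le> f x"
  shows "(\<integral>\<^sup>+x. ennreal (f x) * indicator {0<..<1} x \<partial>lborel) = ennreal (F 1 - F 0)"
proof -
  have "AE x in lborel. x \<noteq> (0::real)" "AE x in lborel. x \<noteq> (1::real)" by (rule AE_lborel_singleton)+
  then have "AE x in lborel. ennreal (f x) * indicator {0<..<1} x = ennreal (f x) * indicator {0..1} x"
    by eventually_elim (auto simp: indicator_def)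
  then have "(\<integral>\<^sup>+x. ennreal (f x) * indicator {0<..<1} x \<partial>lborel) = (\<integral>\<^sup>+x. ennreal (f x) * indicator {0..1} x \<partial>lborel)"
    by (rule nn_integral_cong_AE)
  also have "\<dots> = ennreal (F 1 - F 0)"
    using assms by (intro nn_integral_FTC_Icc) auto
  finally show ?thesis .
qed

text \<open>The probability, under the Gauss measure, that a digit equals
  \<open>r + 1\<close>.\<close>

definition digit_prob :: "nat \<Rightarrow> real" where
  "digit_prob r = log 2 (1 + 1 / (real (Suc r) * (real (Suc r) + 2)))"

lemma nn_integral_gauss_weight: "(\<integral>\<^sup>+x. ennreal (gauss_weight r x) \<partial>gauss_measure) = ennreal (digit_prob r)"
proof -
  define f where "f x = 1 / (ln 2 * ((real r + 1 + x) * (real r + 2 + x)))" for x :: real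
  \<comment> \<open>The factor 1 + x of the weight cancels against the density; \<open>F\<close> is
    the primitive of the remaining partial fractions.\<close>
  define F where "F x = (ln (real r + 1 + x) - ln (real r + 2 + x)) / ln 2" for x :: real
  have [measurable]: "f \<in> borel_measurable borel" unfolding f_def by measurable
  have "(\<integral>\<^sup>+x. ennreal (gauss_weight r x) \<partial>gauss_measure) = (\<integral>\<^sup>+x. ennreal (f x) * indicator {0<..<1} x \<partial>lborel)"
    by (subst nn_integral_gauss_measure, measurable, intro nn_integral_cong)
      (auto simp: gauss_density_def gauss_weight_def f_def indicator_def simp flip: ennreal_mult')
  also have "\<dots> = ennreal (F 1 - F 0)"
  proof (rule nn_integral_unit_FTC)
    fix x :: real assume "x \<in> {0..1}"
    then have x: "0 < real r + 1 + x" "0 < real r + 2 + x" "0 \<le> x" by auto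
    then show "0 \<le> f x" by (simp add: f_def)
    have "(F has_real_derivative (1 / (real r + 1 + x) - 1 / (real r + 2 + x)) / ln 2) (at x)"
      unfolding F_def using x by (auto intro!: derivative_eq_intros)
    also have "(1 / (real r + 1 + x) - 1 / (real r + 2 + x)) / ln 2 = f x"
      unfolding f_def using x by (subst diff_frac_eq) (auto simp: mult.commute)
    finally show "(F has_real_derivative f x) (at x)" .
  qed measurable
  also have "F 1 - F 0 = digit_prob r"
  proof -
    have "1 + 1 / (real (Suc r) * (real (Suc r) + 2)) = ((real r + 2) * (real r + 2)) / ((real r + 1) * (real r + 3))"
    proof -
      have "(real r + 2) * (real r + 2) = (real r + 1) * (real r + 3) + 1" by (simp add: algebra_simps)
      moreover have "(real r + 1) * (real r + 3) \<noteq> 0" by simp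
      ultimately show ?thesis by (simp add: add_divide_distrib add.commute del: mult_eq_0_iff)
    qed
    then show ?thesis
      unfolding digit_prob_def F_def log_def
      by (simp add: ln_div ln_mult diff_divide_distrib add_divide_distrib add_ac)
  qed
  finally show ?thesis .
qed

lemma prob_space_gauss_measure: "prob_space gauss_measure"
proof
  define F where "F x = ln (1 + x) / ln 2" for x :: real
  have "emeasure gauss_measure (space gauss_measure) = (\<integral>\<^sup>+x. ennreal (1 / (ln 2 * (1 + x))) * indicator {0<..<1} x \<partial>lborel)"
    unfolding gauss_measure_def by (subst emeasure_density) (auto intro!: nn_integral_cong simp: gauss_density_def indicator_def)
  also have "\<dots> = ennreal (F 1 - F 0)"
  proof (rule nn_integral_unit_FTC)
    fix x :: real assume "x \<in> {0..1}"
    then show "0 \<le> 1 / (ln 2 * (1 + x))" by simp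
    have "(F has_real_derivative 1 / (1 + x) / ln 2) (at x)"
      unfolding F_def using \<open>x \<in> {0..1}\<close> by (auto intro!: derivative_eq_intros)
    then show "(F has_real_derivative 1 / (ln 2 * (1 + x))) (at x)" by (simp add: mult.commute)
  qed measurable
  also have "F 1 - F 0 = 1" by (simp add: F_def)
  finally show "emeasure gauss_measure (space gauss_measure) = 1" by simp
qed

interpretation gauss: prob_space gauss_measure
  by (rule prob_space_gauss_measure)

lemma gauss_map_branch: "x \<in> {0<..<1} \<Longrightarrow> gauss_map (gauss_branch r x) = x"
proof -
  assume "x \<in> {0<..<1}"
  then have "\<lfloor>real r + 1 + x\<rfloor> = int r + 1" by (simp add: floor_eq_iff)
  then show ?thesis by (simp add: gauss_map_def gauss_branch_def frac_def)
qed

lemma digit_branch: "x \<in> {0<..<1} \<Longrightarrow> nat \<lfloor>1 / gauss_branch r x\<rfloor> = Suc r"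
proof -
  assume "x \<in> {0<..<1}"
  then have "\<lfloor>real r + 1 + x\<rfloor> = int r + 1" by (simp add: floor_eq_iff)
  then show ?thesis by (simp add: gauss_branch_def nat_add_distrib)
qed

text \<open>Branches are decreasing while the substitution rule wants a nonnegative derivative, so
  the integral is first reflected and \<open>g\<close> is the negated branch. Endpoints are null
  sets.\<close>

lemma nn_integral_gauss_branch:
  fixes G :: "real \<Rightarrow> ennreal"
  assumes [measurable]: "G \<in> borel_measurable borel"
  shows "(\<integral>\<^sup>+x. G x * indicator {1 / (real r + 2)<..1 / (real r + 1)} x \<partial>lborel)
    = (\<integral>\<^sup>+y. G (gauss_branch r y) * ennreal (1 / (real r + 1 + y)\<^sup>2) * indicator {0<..<1} y \<partial>lborel)"
proof -
  define g where "g y = - (1 / (real r + 1 + y))" for y :: real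
  have "AE x in lborel. x \<noteq> 1 / (real r + 2)" by (rule AE_lborel_singleton)
  then have "AE x in lborel. G x * indicator {1 / (real r + 2)<..1 / (real r + 1)} x = G x * indicator {1 / (real r + 2)..1 / (real r + 1)} x"
    by eventually_elim (auto simp: indicator_def)
  then have "(\<integral>\<^sup>+x. G x * indicator {1 / (real r + 2)<..1 / (real r + 1)} x \<partial>lborel)
      = (\<integral>\<^sup>+x. G x * indicator {1 / (real r + 2)..1 / (real r + 1)} x \<partial>lborel)"
    by (rule nn_integral_cong_AE)
  also have "\<dots> = (\<integral>\<^sup>+x. G (- x) * indicator {1 / (real r + 2)..1 / (real r + 1)} (- x) \<partial>lborel)"
    by (subst nn_integral_real_affine[where c = "-1" and t = 0]) auto
  also have "\<dots> = (\<integral>\<^sup>+x. G (- x) * indicator {g 0..g 1} x \<partial>lborel)"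
    by (intro nn_integral_cong) (auto simp: g_def indicator_def add.commute)
  also have "\<dots> = (\<integral>\<^sup>+y. G (- g y) * ennreal (1 / (real r + 1 + y)\<^sup>2) * indicator {0..1} y \<partial>lborel)"
  proof (rule nn_integral_substitution_aux)
    fix y :: real assume "y \<in> {0..1}"
    then have "real r + 1 + y \<noteq> 0" by auto
    then show "(g has_real_derivative 1 / (real r + 1 + y)\<^sup>2) (at y)"
      unfolding g_def by (auto intro!: derivative_eq_intros simp: power2_eq_square)
  qed (auto intro!: continuous_intros)
  also have "\<dots> = (\<integral>\<^sup>+y. G (gauss_branch r y) * ennreal (1 / (real r + 1 + y)\<^sup>2) * indicator {0<..<1} y \<partial>lborel)"
  proof (rule nn_integral_cong_AE)
    have "AE x in lborel. x \<noteq> (0::real)" "AE x in lborel. x \<noteq> (1::real)" by (rule AE_lborel_singleton)+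
    then show "AE y in lborel. G (- g y) * ennreal (1 / (real r + 1 + y)\<^sup>2) * indicator {0..1} y
        = G (gauss_branch r y) * ennreal (1 / (real r + 1 + y)\<^sup>2) * indicator {0<..<1} y"
      by eventually_elim (auto simp: indicator_def g_def gauss_branch_def)
  qed
  finally show ?thesis .
qed

text \<open>The intervals are the level sets of the first digit, hence they partition (0,1].\<close>

lemma suminf_indicator_branch_intervals:
  "(\<Sum>r. indicator {1 / (real r + 2)<..1 / (real r + 1)} x :: ennreal) = indicator {0<..1} x"
proof -
  let ?A = "\<lambda>r. {1 / (real r + 2)<..1 / (real r + 1)}"
  have iff: "x \<in> ?A r \<longleftrightarrow> 0 < x \<and> \<lfloor>1 / x\<rfloor> = int r + 1" for r and x :: real
  proof (cases "0 < x")
    case True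
    then show ?thesis by (auto simp: floor_eq_iff field_simps)
  next
    case False
    have "0 < 1 / (real r + 2)" by simp
    then have "x \<notin> ?A r" using False unfolding greaterThanAtMost_iff by linarith
    with False show ?thesis by blast
  qed
  have "m = n" if "x \<in> ?A m" "x \<in> ?A n" for x m n
    using that unfolding iff by simp
  then have "disjoint_family ?A" unfolding disjoint_family_on_def by blast
  moreover have "(\<Union>r. ?A r) = {0<..1}"
  proof (rule set_eqI)
    fix x :: real
    have "(\<exists>r. z = int r + 1) \<longleftrightarrow> 1 \<le> z" for z
      by (auto intro!: exI[of _ "nat (z - 1)"])
    then have "(\<exists>r. x \<in> ?A r) \<longleftrightarrow> 0 < x \<and> 1 \<le> \<lfloor>1 / x\<rfloor>"
      unfolding iff by blast
    also have "\<dots> \<longleftrightarrow> x \<in> {0<..1}" by (auto simp: le_floor_iff)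
    finally show "x \<in> (\<Union>r. ?A r) \<longleftrightarrow> x \<in> {0<..1}" by blast
  qed
  ultimately show ?thesis by (simp add: suminf_indicator)
qed

text \<open>Cut (0,1] by the first digit and substitute on each piece. On a branch
  \<open>gauss_map\<close> is undone, so \<open>h\<close> comes out of the sum. Working in
  \<open>ennreal\<close> lets sums and integrals be exchanged freely.\<close>

lemma gauss_transfer_duality:
  fixes g h :: "real \<Rightarrow> ennreal"
  assumes [measurable]: "g \<in> borel_measurable borel" "h \<in> borel_measurable borel"
  shows "(\<integral>\<^sup>+x. g x * h (gauss_map x) \<partial>gauss_measure)
    = (\<integral>\<^sup>+y. (\<Sum>r. ennreal (gauss_weight r y) * g (gauss_branch r y)) * h y \<partial>gauss_measure)"
proof -
  define G where "G x = ennreal (gauss_density x) * (g x * h (gauss_map x))" for x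
  have [measurable]: "G \<in> borel_measurable borel" unfolding G_def by measurable
  have G1: "G x * indicator {0<..1} x = G x" for x
    by (auto simp: G_def gauss_density_def indicator_def)
  have "(\<integral>\<^sup>+x. g x * h (gauss_map x) \<partial>gauss_measure) = (\<integral>\<^sup>+x. G x \<partial>lborel)"
    unfolding G_def by (rule nn_integral_gauss_measure) measurable
  also have "\<dots> = (\<integral>\<^sup>+x. (\<Sum>r. G x * indicator {1 / (real r + 2)<..1 / (real r + 1)} x) \<partial>lborel)"
    by (simp add: ennreal_suminf_cmult suminf_indicator_branch_intervals G1)
  also have "\<dots> = (\<Sum>r. \<integral>\<^sup>+x. G x * indicator {1 / (real r + 2)<..1 / (real r + 1)} x \<partial>lborel)"
    by (rule nn_integral_suminf) measurable
  also have "\<dots> = (\<Sum>r. \<integral>\<^sup>+y. ennreal (gauss_density y) * (ennreal (gauss_weight r y) * g (gauss_branch r y) * h y) \<partial>lborel)"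
  proof (intro suminf_cong)
    fix r
    have "G (gauss_branch r y) * ennreal (1 / (real r + 1 + y)\<^sup>2) * indicator {0<..<1} y
        = ennreal (gauss_density y) * (ennreal (gauss_weight r y) * g (gauss_branch r y) * h y)" for y
    proof (cases "y \<in> {0<..<1}")
      case True
      \<comment> \<open>With a = r + 1 + y: density at the branch point times Jacobian equals
        density at y times weight. This identity dictates the form of the weights.\<close>
      have "gauss_density (1 / a) * (1 / a\<^sup>2) = 1 / (ln 2 * (a * (a + 1)))" if "1 < a" for a
      proof -
        have "1 + 1 / a = (a + 1) / a" using that by (simp add: add_divide_distrib)
        then show ?thesis using that by (simp add: gauss_density_def power2_eq_square)
      qed
      from this[of "real r + 1 + y"]
      have "gauss_density (gauss_branch r y) * (1 / (real r + 1 + y)\<^sup>2) = gauss_density y * gauss_weight r y"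
        using True by (simp add: gauss_branch_def gauss_weight_def gauss_density_def add_ac)
      then have "ennreal (gauss_density (gauss_branch r y)) * ennreal (1 / (real r + 1 + y)\<^sup>2)
          = ennreal (gauss_density y) * ennreal (gauss_weight r y)"
        using True by (simp add: gauss_weight_nonneg flip: ennreal_mult)
      then show ?thesis
        unfolding G_def gauss_map_branch[OF True] using True
        by (simp add: mult_ac)
    qed (simp add: gauss_density_def)
    then show "(\<integral>\<^sup>+x. G x * indicator {1 / (real r + 2)<..1 / (real r + 1)} x \<partial>lborel)
        = (\<integral>\<^sup>+y. ennreal (gauss_density y) * (ennreal (gauss_weight r y) * g (gauss_branch r y) * h y) \<partial>lborel)"
      by (subst nn_integral_gauss_branch) auto
  qed
  also have "\<dots> = (\<integral>\<^sup>+y. (\<Sum>r. ennreal (gauss_density y) * (ennreal (gauss_weight r y) * g (gauss_branch r y) * h y)) \<partial>lborel)"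
    by (rule nn_integral_suminf[symmetric]) measurable
  also have "\<dots> = (\<integral>\<^sup>+y. (\<Sum>r. ennreal (gauss_weight r y) * g (gauss_branch r y)) * h y \<partial>gauss_measure)"
    by (subst nn_integral_gauss_measure) (auto simp: ennreal_suminf_cmult ennreal_suminf_multc)
  finally show ?thesis .
qed

section \<open>Averages over continued fraction digits\<close>

text \<open>Duality with the constant function 1, which the transfer operator fixes because the
  weights sum to 1.\<close>

lemma gauss_measure_invariant:
  assumes [measurable]: "h \<in> borel_measurable borel"
  shows "(\<integral>\<^sup>+x. h ((gauss_map ^^ n) x) \<partial>gauss_measure) = (\<integral>\<^sup>+x. h x \<partial>gauss_measure)"
proof (induction n)
  case (Suc n)
  have "(\<integral>\<^sup>+x. h ((gauss_map ^^ Suc n) x) \<partial>gauss_measure) = (\<integral>\<^sup>+x. 1 * h ((gauss_map ^^ n) (gauss_map x)) \<partial>gauss_measure)"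
    by (simp add: funpow_swap1)
  also have "\<dots> = (\<integral>\<^sup>+y. (\<Sum>r. ennreal (gauss_weight r y) * 1) * h ((gauss_map ^^ n) y) \<partial>gauss_measure)"
    by (rule gauss_transfer_duality) auto
  also have "\<dots> = (\<integral>\<^sup>+y. h ((gauss_map ^^ n) y) \<partial>gauss_measure)"
  proof (rule nn_integral_cong_AE)
    show "AE y in gauss_measure. (\<Sum>r. ennreal (gauss_weight r y) * 1) * h ((gauss_map ^^ n) y) = h ((gauss_map ^^ n) y)"
      using AE_gauss_measure_unit
    proof eventually_elim
      case (elim y)
      have "(\<Sum>r. ennreal (gauss_weight r y)) = ennreal (\<Sum>r. gauss_weight r y)"
        using gauss_weight_nonneg[OF elim] sums_summable[OF gauss_weight_sums[OF elim]]
        by (intro suminf_ennreal2) auto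
      then show ?case using sums_unique[OF gauss_weight_sums[OF elim]] by simp
    qed
  qed
  finally show ?case using Suc by simp
qed simp

text \<open>Each duality step removes one iterate from \<open>h\<close> and applies the transfer
  operator to \<open>g\<close>, preserving the mean \<open>E\<close> and shrinking \<open>L\<close>
  by 7/8. Without iterates, a function with Lipschitz constant \<open>L\<close> on an interval of
  length 1 exceeds its mean by at most \<open>L\<close>. All regularity is asked of
  \<open>g\<close>, so \<open>h\<close> may be a discontinuous digit function.\<close>

lemma nn_integral_lipschitz_decorrelation:
  fixes g :: "real \<Rightarrow> real" and h :: "real \<Rightarrow> ennreal"
  assumes "L-lipschitz_on {0<..<1} g" and "\<And>x. x \<in> {0<..<1} \<Longrightarrow> 0 \<le> g x"
    and "g \<in> borel_measurable borel" "h \<in> borel_measurable borel"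
    and "0 \<le> E" and "(\<integral>\<^sup>+x. ennreal (g x) \<partial>gauss_measure) = ennreal E"
  shows "(\<integral>\<^sup>+x. ennreal (g x) * h ((gauss_map ^^ n) x) \<partial>gauss_measure)
    \<le> ennreal (E + (7 / 8) ^ n * L) * (\<integral>\<^sup>+x. h x \<partial>gauss_measure)"
  using assms
proof (induction n arbitrary: g L)
  case 0
  note [measurable] = \<open>g \<in> borel_measurable borel\<close> \<open>h \<in> borel_measurable borel\<close>
  have L: "0 \<le> L" using 0(1) by (rule lipschitz_on_nonneg)
  have le: "ennreal (g x) \<le> ennreal (E + L)" if x: "x \<in> {0<..<1}" for x
  proof -
    have "ennreal (g x) = (\<integral>\<^sup>+y. ennreal (g x) \<partial>gauss_measure)"
      by (simp add: gauss.emeasure_space_1[simplified])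
    also have "\<dots> \<le> (\<integral>\<^sup>+y. ennreal (g y) + ennreal L \<partial>gauss_measure)"
    proof (rule nn_integral_mono_AE)
      show "AE y in gauss_measure. ennreal (g x) \<le> ennreal (g y) + ennreal L"
        using AE_gauss_measure_unit
      proof eventually_elim
        case (elim y)
        have "dist (g x) (g y) \<le> L * dist x y" by (rule lipschitz_onD[OF 0(1) x elim])
        also have "\<dots> \<le> L * 1" using x elim L by (intro mult_left_mono) (auto simp: dist_real_def)
        finally have "g x \<le> g y + L" by (simp add: dist_real_def)
        then show ?case using L 0(2)[OF elim] by (simp add: ennreal_leI flip: ennreal_plus)
      qed
    qed
    also have "\<dots> = ennreal (E + L)"
      using 0 L by (simp add: nn_integral_add gauss.emeasure_space_1[simplified])
    finally show ?thesis .
  qed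
  have "(\<integral>\<^sup>+x. ennreal (g x) * h x \<partial>gauss_measure) \<le> (\<integral>\<^sup>+x. ennreal (E + L) * h x \<partial>gauss_measure)"
  proof (rule nn_integral_mono_AE)
    show "AE x in gauss_measure. ennreal (g x) * h x \<le> ennreal (E + L) * h x"
      using AE_gauss_measure_unit by eventually_elim (intro mult_right_mono le, auto)
  qed
  also have "\<dots> = ennreal (E + L) * (\<integral>\<^sup>+x. h x \<partial>gauss_measure)"
    by (rule nn_integral_cmult) measurable
  finally show ?case by simp
next
  case (Suc n)
  note [measurable] = \<open>g \<in> borel_measurable borel\<close> \<open>h \<in> borel_measurable borel\<close>
  have g'0: "0 \<le> gauss_transfer g x" if "x \<in> {0<..<1}" for x
    unfolding gauss_transfer_def
    by (intro suminf_nonneg summable_gauss_transfer[OF Suc.prems(1)] mult_nonneg_nonneg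
        gauss_weight_nonneg Suc.prems(2) gauss_branch_in_unit that)
  have tr: "AE y in gauss_measure. (\<Sum>r. ennreal (gauss_weight r y) * ennreal (g (gauss_branch r y))) = ennreal (gauss_transfer g y)"
    using AE_gauss_measure_unit
  proof eventually_elim
    case (elim y)
    have "(\<Sum>r. ennreal (gauss_weight r y * g (gauss_branch r y))) = ennreal (gauss_transfer g y)"
      unfolding gauss_transfer_def
      by (intro suminf_ennreal2 summable_gauss_transfer[OF Suc.prems(1)] mult_nonneg_nonneg
          gauss_weight_nonneg Suc.prems(2) gauss_branch_in_unit elim)
    then show ?case
      using gauss_weight_nonneg[OF elim] Suc.prems(2)[OF gauss_branch_in_unit[OF elim]]
      by (simp add: ennreal_mult)
  qed
  have dual: "(\<integral>\<^sup>+x. ennreal (g x) * k (gauss_map x) \<partial>gauss_measure) = (\<integral>\<^sup>+y. ennreal (gauss_transfer g y) * k y \<partial>gauss_measure)"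
    if [measurable]: "k \<in> borel_measurable borel" for k
  proof -
    have "(\<integral>\<^sup>+x. ennreal (g x) * k (gauss_map x) \<partial>gauss_measure)
        = (\<integral>\<^sup>+y. (\<Sum>r. ennreal (gauss_weight r y) * ennreal (g (gauss_branch r y))) * k y \<partial>gauss_measure)"
      by (rule gauss_transfer_duality) measurable
    also have "\<dots> = (\<integral>\<^sup>+y. ennreal (gauss_transfer g y) * k y \<partial>gauss_measure)"
      by (intro nn_integral_cong_AE, use tr in eventually_elim) simp
    finally show ?thesis .
  qed
  have "(\<integral>\<^sup>+y. ennreal (gauss_transfer g y) \<partial>gauss_measure) = ennreal E"
    using dual[of "\<lambda>_. 1"] Suc.prems by simp
  then have "(\<integral>\<^sup>+x. ennreal (gauss_transfer g x) * h ((gauss_map ^^ n) x) \<partial>gauss_measure)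
      \<le> ennreal (E + (7 / 8) ^ n * (7 / 8 * L)) * (\<integral>\<^sup>+x. h x \<partial>gauss_measure)"
    using Suc.prems g'0 by (intro Suc.IH lipschitz_on_gauss_transfer) auto
  moreover have "(\<integral>\<^sup>+x. ennreal (g x) * h ((gauss_map ^^ Suc n) x) \<partial>gauss_measure)
      = (\<integral>\<^sup>+x. ennreal (gauss_transfer g x) * h ((gauss_map ^^ n) x) \<partial>gauss_measure)"
    using dual[of "\<lambda>x. h ((gauss_map ^^ n) x)"] by (simp add: funpow_swap1)
  ultimately show ?case by (simp add: mult_ac)
qed

section \<open>Distribution of one digit and convergence of averages\<close>

lemma digit_prob_nonneg: "0 \<le> digit_prob r"
  unfolding digit_prob_def log_def by (intro divide_nonneg_nonneg ln_ge_zero) auto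

lemma digit_prob_le: "digit_prob r \<le> 2 / (real r + 1)\<^sup>2"
proof -
  let ?d = "real (Suc r) * (real (Suc r) + 2)"
  have "ln (1 + 1 / ?d) \<le> 1 / ?d" by (rule ln_add_one_self_le_self) simp
  then have "digit_prob r \<le> (1 / ?d) / ln 2"
    unfolding digit_prob_def log_def by (intro divide_right_mono) auto
  also have "\<dots> \<le> (1 / ?d) / (1 / 2)"
    using ln2_ge_two_thirds by (intro divide_left_mono) auto
  also have "\<dots> \<le> 2 / (real r + 1)\<^sup>2"
    by (simp add: power2_eq_square divide_simps) (simp add: algebra_simps)
  finally show ?thesis .
qed

lemma nn_integral_gauss_digit:
  assumes "\<And>k. 0 \<le> f k" and "summable (\<lambda>r. digit_prob r * f (Suc r))"
  shows "(\<integral>\<^sup>+x. ennreal (f (nat \<lfloor>1 / x\<rfloor>)) \<partial>gauss_measure) = ennreal (\<Sum>r. digit_prob r * f (Suc r))"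
proof -
  have "(\<integral>\<^sup>+x. ennreal (f (nat \<lfloor>1 / x\<rfloor>)) \<partial>gauss_measure)
      = (\<integral>\<^sup>+y. (\<Sum>r. ennreal (gauss_weight r y) * ennreal (f (nat \<lfloor>1 / gauss_branch r y\<rfloor>))) * 1 \<partial>gauss_measure)"
    using gauss_transfer_duality[of "\<lambda>x. ennreal (f (nat \<lfloor>1 / x\<rfloor>))" "\<lambda>_. 1"] by simp
  also have "\<dots> = (\<integral>\<^sup>+y. (\<Sum>r. ennreal (gauss_weight r y) * ennreal (f (Suc r))) \<partial>gauss_measure)"
    by (intro nn_integral_cong_AE, use AE_gauss_measure_unit in eventually_elim) (simp add: digit_branch)
  also have "\<dots> = (\<Sum>r. \<integral>\<^sup>+y. ennreal (gauss_weight r y) * ennreal (f (Suc r)) \<partial>gauss_measure)"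
    by (rule nn_integral_suminf) measurable
  also have "\<dots> = (\<Sum>r. ennreal (digit_prob r * f (Suc r)))"
    using assms(1) by (simp add: nn_integral_multc nn_integral_gauss_weight digit_prob_nonneg flip: ennreal_mult')
  also have "\<dots> = ennreal (\<Sum>r. digit_prob r * f (Suc r))"
    using assms by (intro suminf_ennreal2) (auto simp: digit_prob_nonneg)
  finally show ?thesis .
qed

text \<open>Summability of the squares over (r+1)^2 amounts to a finite second moment. The function
  \<open>F\<close> of the first digit is not Lipschitz, but its image \<open>G\<close> under the
  transfer operator is, so decorrelation starts after one step.\<close>

theorem digit_averages_tendsto:
  fixes f :: "nat \<Rightarrow> real"
  assumes f: "\<And>k. 0 \<le> f k" and sq: "summable (\<lambda>r. (f (Suc r))\<^sup>2 / (real r + 1)\<^sup>2)"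
  shows "AE x in gauss_measure. (\<lambda>n. (\<Sum>i<n. f (nat \<lfloor>1 / (gauss_map ^^ i) x\<rfloor>)) / real n) \<longlonglongrightarrow> (\<Sum>r. digit_prob r * f (Suc r))"
proof -
  have inv2: "summable (\<lambda>r. 1 / (real r + 1)\<^sup>2)"
    using inverse_power_summable[of 2, where 'a=real, THEN summable_ignore_initial_segment, of 1]
    by (simp add: inverse_eq_divide add.commute)
  have s1: "summable (\<lambda>r. f (Suc r) / (real r + 1)\<^sup>2)"
  proof (rule summable_comparison_test'[of _ 0])
    show "summable (\<lambda>r. 1 / (real r + 1)\<^sup>2 + (f (Suc r))\<^sup>2 / (real r + 1)\<^sup>2)"
      by (intro summable_add inv2 sq)
    fix r
    have "f (Suc r) \<le> 1 + (f (Suc r))\<^sup>2"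
      using zero_le_power2[of "f (Suc r) - 1"] f[of "Suc r"] by (simp add: power2_diff)
    then show "norm (f (Suc r) / (real r + 1)\<^sup>2) \<le> 1 / (real r + 1)\<^sup>2 + (f (Suc r))\<^sup>2 / (real r + 1)\<^sup>2"
      using f[of "Suc r"] by (simp add: divide_right_mono flip: add_divide_distrib)
  qed
  \<comment> \<open>Stated for arbitrary \<open>w\<close> because both \<open>digit_prob\<close> and
    the weights at a fixed point obey this bound.\<close>
  have pbound: "summable (\<lambda>r. w r * g (Suc r))"
    if "summable (\<lambda>r. g (Suc r) / (real r + 1)\<^sup>2)" "\<And>k. 0 \<le> g k" "\<And>r. 0 \<le> w r" "\<And>r. w r \<le> 2 / (real r + 1)\<^sup>2"
    for w and g :: "nat \<Rightarrow> real"
  proof (rule summable_comparison_test'[of _ 0])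
    show "summable (\<lambda>r. 2 * (g (Suc r) / (real r + 1)\<^sup>2))" by (intro summable_mult that)
    fix r
    show "norm (w r * g (Suc r)) \<le> 2 * (g (Suc r) / (real r + 1)\<^sup>2)"
      using that mult_right_mono[OF that(4)[of r] that(2)[of "Suc r"]] by (simp add: abs_mult)
  qed
  define m where "m = (\<Sum>r. digit_prob r * f (Suc r))"
  define v where "v = (\<Sum>r. digit_prob r * (f (Suc r))\<^sup>2)"
  define F where "F x = f (nat \<lfloor>1 / x\<rfloor>)" for x :: real
  define G where "G x = (\<Sum>r. gauss_weight r x * f (Suc r))" for x
  define L where "L = 3 * (\<Sum>r. \<bar>f (Suc r)\<bar> / (real r + 1)\<^sup>2)"
  define X where "X i x = F ((gauss_map ^^ i) x)" for i x
  have F0: "0 \<le> F x" for x by (simp add: F_def f)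
  have [measurable]: "F \<in> borel_measurable borel" unfolding F_def by measurable
  have [measurable]: "G \<in> borel_measurable borel" unfolding G_def by measurable
  have [measurable]: "X i \<in> borel_measurable borel" for i unfolding X_def by measurable
  have m0: "0 \<le> m" unfolding m_def
    by (intro suminf_nonneg pbound s1 f digit_prob_nonneg digit_prob_le mult_nonneg_nonneg)
  have v0: "0 \<le> v" unfolding v_def
    by (intro suminf_nonneg pbound[of "\<lambda>k. (f k)\<^sup>2"] sq zero_le_power2 digit_prob_nonneg digit_prob_le mult_nonneg_nonneg)
  have L0: "0 \<le> L" unfolding L_def
    using s1 f by (intro mult_nonneg_nonneg suminf_nonneg) (auto simp: abs_of_nonneg)
  have EF: "(\<integral>\<^sup>+x. ennreal (F x) \<partial>gauss_measure) = ennreal m"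
    unfolding F_def m_def by (intro nn_integral_gauss_digit f pbound s1 digit_prob_nonneg digit_prob_le)
  have EF2: "(\<integral>\<^sup>+x. ennreal ((F x)\<^sup>2) \<partial>gauss_measure) = ennreal v"
    unfolding F_def v_def
    by (intro nn_integral_gauss_digit[of "\<lambda>k. (f k)\<^sup>2"] pbound[of "\<lambda>k. (f k)\<^sup>2"] sq zero_le_power2 digit_prob_nonneg digit_prob_le)
  have w: "gauss_weight r x \<le> 2 / (real r + 1)\<^sup>2" if "x \<in> {0<..<1}" for r x
    unfolding gauss_weight_def power2_eq_square using that by (intro frac_le mult_mono) auto
  have sG: "summable (\<lambda>r. gauss_weight r x * f (Suc r))" if "x \<in> {0<..<1}" for x
    using that by (intro pbound s1 f gauss_weight_nonneg w)
  have GL: "L-lipschitz_on {0<..<1} G"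
    unfolding L_def G_def using s1 f by (intro lipschitz_on_gauss_weight_series sG) (auto simp: abs_of_nonneg)
  have G0: "0 \<le> G x" if "x \<in> {0<..<1}" for x
    unfolding G_def using that by (intro suminf_nonneg sG mult_nonneg_nonneg f gauss_weight_nonneg)
  have dual: "(\<integral>\<^sup>+x. ennreal (F x) * k (gauss_map x) \<partial>gauss_measure) = (\<integral>\<^sup>+y. ennreal (G y) * k y \<partial>gauss_measure)"
    if [measurable]: "k \<in> borel_measurable borel" for k
  proof -
    have "(\<integral>\<^sup>+x. ennreal (F x) * k (gauss_map x) \<partial>gauss_measure)
        = (\<integral>\<^sup>+y. (\<Sum>r. ennreal (gauss_weight r y) * ennreal (F (gauss_branch r y))) * k y \<partial>gauss_measure)"
      by (rule gauss_transfer_duality) measurable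
    also have "\<dots> = (\<integral>\<^sup>+y. ennreal (G y) * k y \<partial>gauss_measure)"
    proof (intro nn_integral_cong_AE, use AE_gauss_measure_unit in eventually_elim)
      case (elim y)
      have "(\<Sum>r. ennreal (gauss_weight r y * f (Suc r))) = ennreal (G y)"
        unfolding G_def using f elim by (intro suminf_ennreal2 sG mult_nonneg_nonneg gauss_weight_nonneg) auto
      then show ?case
        using gauss_weight_nonneg[OF elim] f by (simp add: F_def digit_branch[OF elim] ennreal_mult)
    qed
    finally show ?thesis .
  qed
  have EG: "(\<integral>\<^sup>+x. ennreal (G x) \<partial>gauss_measure) = ennreal m"
    using dual[of "\<lambda>_. 1"] EF by simp
  have EX: "(\<integral>\<^sup>+x. ennreal (X i x) \<partial>gauss_measure) = ennreal m" for i
    unfolding X_def by (subst gauss_measure_invariant[of "\<lambda>x. ennreal (F x)"]) (simp_all add: EF)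
  \<comment> \<open>The summand \<open>v\<close> covers lag 0. For lag n + 1 only n contractions are
    available, one step being spent on passing from \<open>F\<close> to \<open>G\<close>; the 2
    makes up for the missing 7/8.\<close>
  define B where "B = v + 2 * L * m"
  have B0: "0 \<le> B" using v0 L0 m0 by (simp add: B_def)
  have EXX: "(\<integral>\<^sup>+x. ennreal (X i x * X j x) \<partial>gauss_measure) \<le> ennreal (m\<^sup>2 + B * (7 / 8) ^ (j - i))" if "i \<le> j" for i j
  proof -
    let ?T = "\<lambda>n. (gauss_map ^^ n)"
    \<comment> \<open>Invariance under the i-th iterate reduces the pair (i, j) to (0, j -
      i).\<close>
    have "X i x * X j x = F (?T i x) * F (?T (j - i) (?T i x))" for x
      using that unfolding X_def by (simp flip: funpow_add[THEN fun_cong, unfolded o_apply])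
    then have "(\<integral>\<^sup>+x. ennreal (X i x * X j x) \<partial>gauss_measure) = (\<integral>\<^sup>+x. ennreal (F x * F (?T (j - i) x)) \<partial>gauss_measure)"
      using gauss_measure_invariant[of "\<lambda>x. ennreal (F x * F (?T (j - i) x))" i] by simp
    also have "\<dots> \<le> ennreal (m\<^sup>2 + B * (7 / 8) ^ (j - i))"
    proof (cases "j - i")
      case 0
      have "v \<le> m\<^sup>2 + B" using L0 m0 by (simp add: B_def)
      then show ?thesis unfolding 0 using EF2 by (simp add: power2_eq_square ennreal_leI)
    next
      case (Suc n)
      have "(\<integral>\<^sup>+x. ennreal (F x * F (?T (Suc n) x)) \<partial>gauss_measure)
          = (\<integral>\<^sup>+x. ennreal (F x) * ennreal (F (?T n (gauss_map x))) \<partial>gauss_measure)"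
        using F0 by (simp add: ennreal_mult funpow_swap1)
      also have "\<dots> = (\<integral>\<^sup>+x. ennreal (G x) * ennreal (F (?T n x)) \<partial>gauss_measure)"
        by (rule dual[of "\<lambda>x. ennreal (F (?T n x))"]) measurable
      also have "\<dots> \<le> ennreal (m + (7 / 8) ^ n * L) * ennreal m"
        using nn_integral_lipschitz_decorrelation[OF GL G0, of "\<lambda>x. ennreal (F x)" m n] m0 EG EF by simp
      also have "\<dots> = ennreal ((m + (7 / 8) ^ n * L) * m)"
        using m0 L0 by (simp add: ennreal_mult)
      also have "\<dots> \<le> ennreal (m\<^sup>2 + B * (7 / 8) ^ Suc n)"
      proof (rule ennreal_leI)
        have "L * m \<le> 7 / 8 * B" using v0 mult_nonneg_nonneg[OF L0 m0] by (simp add: B_def)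
        then have "(7 / 8) ^ n * (L * m) \<le> (7 / 8) ^ n * (7 / 8 * B)" by (rule mult_left_mono) simp
        then show "(m + (7 / 8) ^ n * L) * m \<le> m\<^sup>2 + B * (7 / 8) ^ Suc n"
          by (simp add: power2_eq_square algebra_simps)
      qed
      finally show ?thesis unfolding Suc .
    qed
    finally show ?thesis .
  qed
  have X0: "0 \<le> X i x" for i x by (simp add: X_def F0)
  have intX: "integrable gauss_measure (X i)" for i
    by (rule integrableI_nonneg) (auto simp: X0 EX)
  have intXX: "integrable gauss_measure (\<lambda>x. X i x * X j x)" for i j
  proof (rule integrableI_nonneg)
    have "(\<integral>\<^sup>+x. ennreal (X i x * X j x) \<partial>gauss_measure) < \<infinity>" if "i \<le> j" for i j
      using EXX[OF that] by (rule le_less_trans) simp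
    from this[of i j] this[of j i] show "(\<integral>\<^sup>+x. ennreal (X i x * X j x) \<partial>gauss_measure) < \<infinity>"
      by (cases "i \<le> j") (auto simp: mult.commute)
  qed (auto simp: X0)
  have "AE x in gauss_measure. (\<lambda>n. (\<Sum>i<n. X i x) / real n) \<longlonglongrightarrow> m"
  proof (rule gauss.strong_law_exponential_correlations)
    show "gauss.expectation (X i) = m" for i
      using m0 EX X0 by (intro integral_eq_nn_integral[THEN trans]) auto
    show "gauss.expectation (\<lambda>x. X i x * X j x) \<le> m\<^sup>2 + B * (7 / 8) ^ (j - i)" if "i \<le> j" for i j
    proof -
      have "ennreal (gauss.expectation (\<lambda>x. X i x * X j x)) \<le> ennreal (m\<^sup>2 + B * (7 / 8) ^ (j - i))"
        using EXX[OF that] by (subst nn_integral_eq_integral[symmetric]) (auto intro: intXX simp: X0)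
      then show ?thesis using B0 by (subst (asm) ennreal_le_iff) auto
    qed
  qed (use X0 intX intXX B0 in auto)
  then show ?thesis by (simp add: X_def F_def m_def)
qed

section \<open>Return to Lebesgue measure and to digits indexed from 1\<close>

lemma cf_digit_eq: "cf_digit x (Suc i) = nat \<lfloor>1 / (gauss_map ^^ i) x\<rfloor>"
  by (simp add: cf_digit_def)

lemma gauss_map_irrational_unit:
  assumes "x \<in> {0<..<1}" "x \<notin> \<rat>"
  shows "gauss_map x \<in> {0<..<1} \<and> gauss_map x \<notin> \<rat>"
proof -
  have irr: "gauss_map x \<notin> \<rat>"
  proof
    assume "gauss_map x \<in> \<rat>"
    then have "gauss_map x + of_int \<lfloor>1 / x\<rfloor> \<in> \<rat>" by (intro Rats_add) auto
    then have "1 / x \<in> \<rat>" by (simp add: gauss_map_def frac_def)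
    then have "inverse (1 / x) \<in> \<rat>" by (rule Rats_inverse)
    with assms show False by simp
  qed
  then have "gauss_map x \<noteq> 0" by auto
  moreover have "0 \<le> gauss_map x" "gauss_map x < 1"
    by (auto simp: gauss_map_def frac_lt_1)
  ultimately show ?thesis using irr by simp
qed

text \<open>The orbit of an irrational point never reaches 0, where the convention
  \<open>1 / 0 = 0\<close> would produce the digit 0. Positivity is what the mean inequalities
  require.\<close>

lemma cf_digit_pos:
  assumes "x \<in> {0<..<1}" "x \<notin> \<rat>" "1 \<le> i"
  shows "1 \<le> cf_digit x i"
proof -
  have "(gauss_map ^^ n) x \<in> {0<..<1} \<and> (gauss_map ^^ n) x \<notin> \<rat>" for n
    by (induction n) (use assms gauss_map_irrational_unit in auto)
  from this[of "i - 1"] have "1 \<le> \<lfloor>1 / (gauss_map ^^ (i - 1)) x\<rfloor>" by (simp add: le_floor_iff)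
  then show ?thesis unfolding cf_digit_def by linarith
qed

lemma AE_digit_averages:
  fixes f :: "nat \<Rightarrow> real"
  assumes f: "\<And>k. 0 \<le> f k" and sq: "summable (\<lambda>r. (f (Suc r))\<^sup>2 / (real r + 1)\<^sup>2)"
  shows "AE x in lborel. x \<in> {0<..<1} \<longrightarrow>
    (\<lambda>n. (\<Sum>i=1..n. f (cf_digit x i)) / real n) \<longlonglongrightarrow> (\<Sum>r. digit_prob r * f (Suc r))"
proof -
  have "Measurable.pred borel (\<lambda>x. (\<lambda>n. (\<Sum>i<n. f (nat \<lfloor>1 / (gauss_map ^^ i) x\<rfloor>)) / real n) \<longlonglongrightarrow> (\<Sum>r. digit_prob r * f (Suc r)))"
    by measurable
  from digit_averages_tendsto[OF f sq, unfolded AE_gauss_measure_iff[OF this]]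
  show ?thesis by (simp add: sum.atLeast1_atMost_eq cf_digit_eq)
qed

section \<open>Khinchin's constants as digit averages\<close>

lemma summable_ln_square: "summable (\<lambda>r. (ln (real (Suc r)))\<^sup>2 / (real r + 1)\<^sup>2)"
proof (rule summable_comparison_test_bigo)
  \<comment> \<open>Any exponent strictly between -2 and -1 would do: the gap to -2 absorbs the
    squared logarithm.\<close>
  show "summable (\<lambda>n. norm (real n powr (-3/2)))"
    by (simp add: summable_real_powr_iff)
  show "(\<lambda>r. (ln (real (Suc r)))\<^sup>2 / (real r + 1)\<^sup>2) \<in> O(\<lambda>n. real n powr (-3/2))"
    by real_asymp
qed

lemma summable_inverse_square: "summable (\<lambda>r. (1 / real (Suc r))\<^sup>2 / (real r + 1)\<^sup>2)"
proof (rule summable_comparison_test_bigo)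
  show "summable (\<lambda>n. norm (real n powr (-3/2)))"
    by (simp add: summable_real_powr_iff)
  show "(\<lambda>r. (1 / real (Suc r))\<^sup>2 / (real r + 1)\<^sup>2) \<in> O(\<lambda>n. real n powr (-3/2))"
    by real_asymp
qed

lemma summable_digit_prob_mult:
  assumes "g \<in> O(\<lambda>r. sqrt (real r))"
  shows "summable (\<lambda>r. digit_prob r * g r)"
proof (rule summable_comparison_test_bigo)
  show "summable (\<lambda>n. norm (real n powr (-3/2)))"
    by (simp add: summable_real_powr_iff)
  have "digit_prob \<in> O(\<lambda>r. real r powr (-2))"
    unfolding digit_prob_def[abs_def] by real_asymp
  then have "(\<lambda>r. digit_prob r * g r) \<in> O(\<lambda>r. real r powr (-2) * sqrt (real r))"
    using assms by (rule landau_o.big.mult)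
  also have "(\<lambda>r. real r powr (-2) * sqrt (real r)) \<in> O(\<lambda>n. real n powr (-3/2))"
    by real_asymp
  finally show "(\<lambda>r. digit_prob r * g r) \<in> O(\<lambda>n. real n powr (-3/2))" .
qed

text \<open>Base and exponent can trade logarithms: (1 + u)^(log_2 r) = exp(log_2(1 + u) ln r). So
  the constant is the almost sure geometric mean of the digits.\<close>

lemma Khinchin_K0_eq: "Khinchin_K0 = exp (\<Sum>r. digit_prob r * ln (real (Suc r)))"
proof -
  have "(1 + 1 / (real (Suc r) * (real (Suc r) + 2))) powr log 2 (real (Suc r)) = exp (digit_prob r * ln (real (Suc r)))" for r
  proof -
    have "0 < 1 + 1 / (real (Suc r) * (real (Suc r) + 2))" by (intro add_pos_nonneg) auto
    then show ?thesis unfolding powr_def digit_prob_def log_def by simp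
  qed
  moreover have "summable (\<lambda>r. digit_prob r * ln (real (Suc r)))"
    by (rule summable_digit_prob_mult) real_asymp
  ultimately show ?thesis unfolding Khinchin_K0_def by (simp add: prodinf_exp)
qed

text \<open>1 - 1/(t+1)^2 is the reciprocal of 1 + 1/(t(t+2)), so the logarithms in the definition
  are negated digit probabilities and the constant is the almost sure harmonic mean.\<close>

lemma Khinchin_Kminus1_eq: "Khinchin_Kminus1 = inverse (\<Sum>r. digit_prob r * (1 / real (Suc r)))"
proof -
  have "- (1 / real (Suc r)) * log 2 (1 - 1 / (real (Suc r) + 1)^2) = digit_prob r * (1 / real (Suc r))" for r
  proof -
    let ?t = "real (Suc r)"
    have t: "0 < ?t * (?t + 2)" "?t + 1 \<noteq> 0" by (auto intro: mult_pos_pos)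
    have e: "(?t + 1)^2 = ?t * (?t + 2) + 1" by (simp add: power2_eq_square algebra_simps)
    have "1 - 1 / (?t + 1)^2 = inverse (1 + 1 / (?t * (?t + 2)))"
      unfolding e using t by (simp add: field_simps)
    then have "log 2 (1 - 1 / (?t + 1)^2) = - digit_prob r"
      using t by (simp add: log_inverse digit_prob_def add_pos_pos del: of_nat_Suc)
    then show ?thesis by simp
  qed
  then show ?thesis unfolding Khinchin_Kminus1_def by simp
qed

lemma mean_inverse_digit_pos: "0 < (\<Sum>r. digit_prob r * (1 / real (Suc r)))"
proof (rule suminf_pos2)
  show "summable (\<lambda>r. digit_prob r * (1 / real (Suc r)))"
    by (rule summable_digit_prob_mult) real_asymp
  show "0 < digit_prob 0 * (1 / real (Suc 0))"
    by (simp add: digit_prob_def)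
qed (simp add: digit_prob_nonneg)

theorem theorem3p2:
  shows "AE \<alpha> in lborel. \<alpha> \<in> {0<..<1} \<and> \<alpha> \<notin> \<rat> \<longrightarrow>
    (\<forall>c::real. 0 < c \<and> c < 1 \<longrightarrow>
      ereal Khinchin_K0 \<le> limsup (\<lambda>n. ereal (S_root \<alpha> c n)) \<and>
      limsup (\<lambda>n. ereal (S_root \<alpha> c n))
        \<le> ereal (Khinchin_K0 powr (1 / c) * Khinchin_Kminus1 powr (1 - 1 / c)))"
proof -
  let ?l = "\<Sum>r. digit_prob r * ln (real (Suc r))"
  let ?q = "\<Sum>r. digit_prob r * (1 / real (Suc r))"
  \<comment> \<open>Nonnegativity is asked at every natural number, including 0, where
    \<open>ln 0 = 0\<close>.\<close>
  have "0 \<le> ln (real k)" for k by (cases "k = 0") auto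
  from AE_digit_averages[of "\<lambda>k. ln (real k)", OF this summable_ln_square]
  have "AE x in lborel. x \<in> {0<..<1} \<longrightarrow> (\<lambda>n. (\<Sum>i=1..n. ln (real (cf_digit x i))) / real n) \<longlonglongrightarrow> ?l" .
  moreover from AE_digit_averages[of "\<lambda>k. 1 / real k", OF _ summable_inverse_square]
  have "AE x in lborel. x \<in> {0<..<1} \<longrightarrow> (\<lambda>n. (\<Sum>i=1..n. 1 / real (cf_digit x i)) / real n) \<longlonglongrightarrow> ?q"
    by simp
  ultimately show ?thesis
  proof eventually_elim
    case (elim x)
    show ?case
    proof (intro impI allI)
      fix c :: real
      assume x: "x \<in> {0<..<1} \<and> x \<notin> \<rat>" and c: "0 < c \<and> c < 1"
      have pos: "0 < real (cf_digit x i)" if "1 \<le> i" for i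
        using cf_digit_pos[of x i] x that by simp
      have root: "S_root x c = (\<lambda>n. ((\<Sum>I\<in>{I. I \<subseteq> {1..n} \<and> card I = nat \<lceil>c * real n\<rceil>}. \<Prod>i\<in>I. real (cf_digit x i))
          / real (n choose nat \<lceil>c * real n\<rceil>)) powr (1 / real (nat \<lceil>c * real n\<rceil>)))"
        by (simp add: fun_eq_iff S_root_def S_cf_def Let_def)
      \<comment> \<open>\<open>?q\<close> is the inverse of \<open>Khinchin_Kminus1\<close>, which
        flips the sign of the exponent.\<close>
      have q: "?q powr (1 / c - 1) = Khinchin_Kminus1 powr (1 - 1 / c)"
        unfolding Khinchin_Kminus1_eq using mean_inverse_digit_pos
        by (simp add: powr_def ln_inverse algebra_simps)
      have lims: "(\<lambda>n. (\<Sum>i=1..n. ln (real (cf_digit x i))) / real n) \<longlonglongrightarrow> ?l"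
          "(\<lambda>n. (\<Sum>i=1..n. 1 / real (cf_digit x i)) / real n) \<longlonglongrightarrow> ?q"
        using elim x by blast+
      show "ereal Khinchin_K0 \<le> limsup (\<lambda>n. ereal (S_root x c n)) \<and>
          limsup (\<lambda>n. ereal (S_root x c n)) \<le> ereal (Khinchin_K0 powr (1 / c) * Khinchin_Kminus1 powr (1 - 1 / c))"
        unfolding root q[symmetric] Khinchin_K0_eq
        using elementary_symmetric_mean_limsup[where a = "\<lambda>i. real (cf_digit x i)", OF pos _ _ mean_inverse_digit_pos lims] c
        by blast
    qed
  qed
qed

end
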